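(* Let $f:\mathbb{C}_0\to\mathbb{C}$ be a function, where $\mathbb{C}_\kappa=\{s=\sigma+it:\sigma>\kappa\}$. The following are equivalent: (i) $f$ is unbounded, analytic, and almost periodic in $\mathbb{C}_\kappa$ for every $\kappa>0$. (ii) $f=p+b$ for some functions $p,b:\mathbb{C}_0\to\mathbb{C}$ such that $p$ is unbounded, analytic, and periodic in $\mathbb{C}_\kappa$ for every $\kappa>0$, and $b$ is bounded, analytic, and almost periodic in $\mathbb{C}_\kappa$ for every $\kappa>0$.
   Context: For real $\kappa$, $\mathbb{C}_\kappa=\{s=\sigma+it:\sigma>\kappa\}$. For real $\tau$, the vertical translation is $V_\tau f(s)=f(s+i\tau)$. A real number $\tau$ is a translation number of $f$ belonging to $\varepsilon>0$ (with respect to $\mathbb{C}_\kappa$) if $|V_\tau f(s)-f(s)|\le\varepsilon$ for all $s\in\mathbb{C}_\kappa$; $E_f(\varepsilon)$ denotes the set of all such $\tau$. A set of real numbers is relatively dense if there is $L>0$ such that the set has non-empty intersection with every interval of length $L$. A continuous function $f$ on $\mathbb{C}_\kappa$ is almost periodic in $\mathbb{C}_\kappa$ if $E_f(\varepsilon)$ is relatively dense for every $\varepsilon>0$. A function $p$ is periodic in $\mathbb{C}_\kappa$ if $V_\tau p=p$ in $\mathbb{C}_\kappa$ for some $\tau>0$ (the translation is always vertical). "Bounded/unbounded in $\mathbb{C}_\kappa$ for every $\kappa>0$" means that for each $\kappa>0$ the restriction to $\mathbb{C}_\kappa$ is bounded/unbounded. *)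

theory Defs
  imports "HOL-Complex_Analysis.Complex_Analysis"
begin

text \<open>
  A function on a half-plane is represented by a total function of type
  \<^typ>\<open>complex \<Rightarrow> complex\<close>; its values outside the half-plane in question are irrelevant
  to every notion below.
\<close>

definition half_plane :: "real \<Rightarrow> complex set" where
  "half_plane \<kappa> = {s. Re s > \<kappa>}"

definition vtranslate :: "real \<Rightarrow> (complex \<Rightarrow> complex) \<Rightarrow> complex \<Rightarrow> complex" where
  "vtranslate \<tau> f s = f (s + \<i> * complex_of_real \<tau>)"

definition translation_numbers :: "real \<Rightarrow> (complex \<Rightarrow> complex) \<Rightarrow> real \<Rightarrow> real set" where
  "translation_numbers \<kappa> f \<epsilon> =
     {\<tau>. \<forall>s\<in>half_plane \<kappa>. norm (vtranslate \<tau> f s - f s) \<le> \<epsilon>}"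

text \<open>
  Every interval of length \<open>L\<close>, whether or not it contains its endpoints, contains the open
  interval with the same endpoints, so it suffices to quantify over the open ones.
\<close>

definition relatively_dense :: "real set \<Rightarrow> bool" where
  "relatively_dense E \<longleftrightarrow> (\<exists>L>0. \<forall>a. E \<inter> {a<..<a + L} \<noteq> {})"

definition almost_periodic_in :: "real \<Rightarrow> (complex \<Rightarrow> complex) \<Rightarrow> bool" where
  "almost_periodic_in \<kappa> f \<longleftrightarrow>
     continuous_on (half_plane \<kappa>) f \<and> (\<forall>\<epsilon>>0. relatively_dense (translation_numbers \<kappa> f \<epsilon>))"

definition periodic_in :: "real \<Rightarrow> (complex \<Rightarrow> complex) \<Rightarrow> bool" where
  "periodic_in \<kappa> p \<longleftrightarrow> (\<exists>\<tau>>0. \<forall>s\<in>half_plane \<kappa>. vtranslate \<tau> p s = p s)"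

definition bounded_in :: "real \<Rightarrow> (complex \<Rightarrow> complex) \<Rightarrow> bool" where
  "bounded_in \<kappa> f \<longleftrightarrow> bounded (f ` half_plane \<kappa>)"

end

theory Submission
  imports Defs "HOL-Real_Asymp.Real_Asymp"
begin

text \<open>
  Let \<open>f\<close> be analytic and almost periodic in every \<open>\<complex>\<^sub>\<kappa>\<close>. On a vertical strip of finite width
  \<open>f\<close> is bounded, because every point can be moved into a compact rectangle by a translation number;
  so \<open>f\<close> can only be unbounded as \<open>Re s \<rightarrow> \<infinity>\<close>. Fix one translation number \<open>\<tau> > 0\<close> of \<open>f\<close> belonging
  to \<open>1\<close> in \<open>\<complex>\<^sub>1\<close>. Then \<open>f(s + i n \<tau>)\<close> differs from \<open>f(s)\<close> by at most \<open>\<bar>n\<bar>\<close>, and this is enough to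
  split off a part of period \<open>i \<tau>\<close>. Take an entire function \<open>k\<close> that decays like \<open>\<bar>Im s\<bar>\<^sup>-\<^sup>4\<close>
  on vertical lines, whose translates by \<open>i n \<tau>\<close> sum to the constant \<open>1\<close>, and which grows only like
  \<open>exp (\<epsilon> \<bar>Re s\<bar>)\<close> horizontally. Then
  \<open>p\<^sub>\<epsilon>(s) = \<Sum>n. k(s + i n \<tau>) f(s + i n \<tau>)\<close> is analytic and periodic, and
  \<open>f(s) - p\<^sub>\<epsilon>(s) = \<Sum>n. k(s + i n \<tau>) (f(s) - f(s + i n \<tau>))\<close> is \<open>O(exp (\<epsilon> Re s))\<close> on each horizontal
  strip (lemma \<open>periodic_approximation\<close>).

  For small rates \<open>\<epsilon>\<close>, the difference of two such functions \<open>p\<^sub>\<epsilon>\<close> is periodic and grows more slowly than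
  \<open>exp (2 \<pi> Re s / \<tau>)\<close>. As a function of \<open>exp (- 2 \<pi> s / \<tau>)\<close> it has a removable singularity at
  the origin, so it is bounded (lemma \<open>periodic_slow_growth_bounded\<close>). Hence a single
  function \<open>p = p\<^sub>\<epsilon>\<close> already satisfies \<open>f - p = O(exp (\<epsilon>' Re s) (1 + \<bar>s\<bar>))\<close> for every \<open>\<epsilon>' > 0\<close>. Since
  \<open>f\<close> and \<open>p\<close> are both bounded on vertical lines, the Phragmen--Lindelof principle shows that
  \<open>b = f - p\<close> is bounded (lemma \<open>periodic_part_exists\<close>).

  What remains is almost periodicity, in both directions of the equivalence, and both rest on the
  same pigeonhole argument: if the translation numbers of a function are relatively dense and the function is
  uniformly continuous in the vertical direction, then so are those among them that are integral
  multiples of a given \<open>\<tau>\<close> (lemma \<open>multiples_relatively_dense\<close>). A multiple of the period of \<open>p\<close>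
  that is a translation number of \<open>b\<close> is one of \<open>p + b\<close>. Conversely, a multiple that is a
  translation number of \<open>f\<close> on the line \<open>Re s = \<kappa>\<close> is one of \<open>b\<close> on that line, and, as \<open>b\<close> is
  bounded, by Phragmen--Lindelof also in \<open>\<complex>\<^sub>\<kappa>\<close>.
\<close>

section \<open>The Phragmen--Lindelof principle in a half-plane\<close>

lemma open_half_plane [simp, intro]: "open (half_plane \<kappa>)"
  unfolding half_plane_def by (rule open_halfspace_Re_gt)

lemma half_plane_shift [simp]:
  "s + \<i> * complex_of_real \<tau> \<in> half_plane \<kappa> \<longleftrightarrow> s \<in> half_plane \<kappa>"
  by (simp add: half_plane_def)

text \<open>
  Dividing \<open>F\<close> by \<open>exp (\<epsilon> (s - \<kappa>)) (1 + \<epsilon> (s - \<kappa>))\<^sup>2\<close>, which has modulus at least \<open>1\<close> on the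
  half-plane, yields a function that is at most \<open>B\<close> on the boundary and tends to \<open>0\<close> at infinity.
  The maximum principle on large half-discs bounds the quotient by every \<open>B' > B\<close>, and
  \<open>\<epsilon> \<rightarrow> 0\<close> removes the divisor.
\<close>

lemma phragmen_lindelof_half_plane:
  assumes hol: "F holomorphic_on half_plane \<kappa>'" and "\<kappa>' < \<kappa>"
    and line: "\<And>s. Re s = \<kappa> \<Longrightarrow> norm (F s) \<le> B"
    and growth: "\<And>\<epsilon>. \<epsilon> > 0 \<Longrightarrow>
       \<exists>C. \<forall>s. Re s \<ge> \<kappa> \<longrightarrow> norm (F s) \<le> C * exp (\<epsilon> * Re s) * (1 + norm s)"
    and s: "Re s \<ge> \<kappa>"
  shows "norm (F s) \<le> B"
proof -
  have "0 \<le> B"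
    by (rule order_trans[OF norm_ge_zero line[of "of_real \<kappa>"]]) simp
  define D where "D = (\<lambda>(\<epsilon>::real) (z::complex). exp (of_real \<epsilon> * (z - of_real \<kappa>)) * (1 + of_real \<epsilon> * (z - of_real \<kappa>)) ^ 2)"
  have D_lower: "norm (D \<epsilon> z) \<ge> exp (\<epsilon> * (Re z - \<kappa>)) * (1 + \<epsilon>\<^sup>2 * (norm (z - of_real \<kappa>))\<^sup>2)"
    if "\<epsilon> > 0" "Re z \<ge> \<kappa>" for \<epsilon> z
  proof -
    have "(norm (1 + of_real \<epsilon> * (z - of_real \<kappa>)))\<^sup>2
        = (1 + \<epsilon> * (Re z - \<kappa>))\<^sup>2 + (\<epsilon> * Im z)\<^sup>2"
      by (simp add: cmod_power2)
    moreover have "(norm (z - of_real \<kappa>))\<^sup>2 = (Re z - \<kappa>)\<^sup>2 + (Im z)\<^sup>2"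
      by (simp add: cmod_power2)
    moreover have "0 \<le> \<epsilon> * (Re z - \<kappa>)" using that by simp
    ultimately have "1 + \<epsilon>\<^sup>2 * (norm (z - of_real \<kappa>))\<^sup>2
        \<le> (norm (1 + of_real \<epsilon> * (z - of_real \<kappa>)))\<^sup>2"
      by (simp only: power_mult_distrib power2_sum distrib_left) simp
    thus ?thesis
      by (simp add: D_def norm_mult norm_power)
  qed
  have bound: "norm (F s) \<le> B' * norm (D \<epsilon> s)" if "\<epsilon> > 0" "B' > B" for \<epsilon> B'
  proof -
    have "B' > 0" using that \<open>0 \<le> B\<close> by simp
    obtain C where C: "\<And>z. Re z \<ge> \<kappa> \<Longrightarrow> norm (F z) \<le> C * exp (\<epsilon> * Re z) * (1 + norm z)"
      using growth[OF \<open>\<epsilon> > 0\<close>] by blast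
    define K where "K = \<bar>C\<bar> * exp (\<epsilon> * \<kappa>)"
    \<comment> \<open>the bound for the quotient on the circular arc of radius \<open>R\<close> around \<open>\<kappa>\<close>\<close>
    have "((\<lambda>R. K * (1 + \<bar>\<kappa>\<bar> + R) / (1 + \<epsilon>\<^sup>2 * R\<^sup>2)) \<longlongrightarrow> 0) at_top"
      using \<open>\<epsilon> > 0\<close> by real_asymp
    hence "\<forall>\<^sub>F R in at_top. K * (1 + \<bar>\<kappa>\<bar> + R) / (1 + \<epsilon>\<^sup>2 * R\<^sup>2) < B'"
      using \<open>B' > 0\<close> by (rule order_tendstoD)
    moreover have "\<forall>\<^sub>F R in at_top. R \<ge> norm (s - of_real \<kappa>)" "\<forall>\<^sub>F R in at_top. R > (0::real)"
      by (auto simp: eventually_ge_at_top eventually_gt_at_top)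
    ultimately have "\<forall>\<^sub>F R in at_top. K * (1 + \<bar>\<kappa>\<bar> + R) / (1 + \<epsilon>\<^sup>2 * R\<^sup>2) < B' \<and>
       R \<ge> norm (s - of_real \<kappa>) \<and> R > 0"
      by eventually_elim auto
    then obtain R where R: "K * (1 + \<bar>\<kappa>\<bar> + R) / (1 + \<epsilon>\<^sup>2 * R\<^sup>2) < B'"
      "R \<ge> norm (s - of_real \<kappa>)" "R > 0"
      unfolding eventually_at_top_linorder by blast
    define S where "S = {z. Re z \<ge> \<kappa>} \<inter> cball (of_real \<kappa>) R"
    have closedS: "closed S"
      unfolding S_def by (intro closed_Int closed_halfspace_Re_ge closed_cball)
    define G where "G = (\<lambda>z. F z / D \<epsilon> z)"
    have Dpos: "norm (D \<epsilon> z) > 0" if "Re z \<ge> \<kappa>" for z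
    proof -
      have "0 < exp (\<epsilon> * (Re z - \<kappa>)) * (1 + \<epsilon>\<^sup>2 * (norm (z - of_real \<kappa>))\<^sup>2)"
        by (intro mult_pos_pos add_pos_nonneg) auto
      with D_lower[OF \<open>\<epsilon> > 0\<close> that] show ?thesis by linarith
    qed
    have S_sub: "S \<subseteq> half_plane \<kappa>'"
      using \<open>\<kappa>' < \<kappa>\<close> by (auto simp: S_def half_plane_def)
    have "D \<epsilon> holomorphic_on S"
      unfolding D_def by (intro holomorphic_intros)
    moreover have "D \<epsilon> z \<noteq> 0" if "z \<in> S" for z
      using Dpos[of z] that by (auto simp: S_def)
    ultimately have holS: "G holomorphic_on S"
      unfolding G_def by (intro holomorphic_on_divide holomorphic_on_subset[OF hol S_sub])
    have "norm (G s) \<le> B'"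
    proof (rule maximum_modulus_frontier[of G S])
      show "G holomorphic_on interior S"
        using holS holomorphic_on_subset interior_subset by blast
      show "continuous_on (closure S) G"
        using holS closedS by (simp add: holomorphic_on_imp_continuous_on)
      show "bounded S"
        unfolding S_def by (simp add: bounded_Int)
      show "s \<in> S"
        using R s by (simp add: S_def dist_norm norm_minus_commute)
      fix z assume z: "z \<in> frontier S"
      hence "z \<in> S" using closedS frontier_subset_closed by blast
      hence zk: "Re z \<ge> \<kappa>" "norm (z - of_real \<kappa>) \<le> R"
        by (auto simp: S_def dist_norm norm_minus_commute)
      have "Re z = \<kappa> \<or> norm (z - of_real \<kappa>) = R"
      proof (rule ccontr)
        assume "\<not> (Re z = \<kappa> \<or> norm (z - of_real \<kappa>) = R)"
        hence "z \<in> {z. Re z > \<kappa>} \<inter> ball (of_real \<kappa>) R"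
          using zk by (auto simp: dist_norm norm_minus_commute)
        moreover have "{z. Re z > \<kappa>} \<inter> ball (of_real \<kappa>) R \<subseteq> interior S"
          by (intro interior_maximal open_Int open_halfspace_Re_gt open_ball) (auto simp: S_def)
        ultimately show False using z by (auto simp: frontier_def)
      qed
      thus "norm (G z) \<le> B'"
      proof
        assume line': "Re z = \<kappa>"
        have "1 + \<epsilon>\<^sup>2 * (norm (z - of_real \<kappa>))\<^sup>2 \<le> norm (D \<epsilon> z)"
          using D_lower[OF \<open>\<epsilon> > 0\<close> zk(1)] line' by simp
        moreover have "0 \<le> \<epsilon>\<^sup>2 * (norm (z - of_real \<kappa>))\<^sup>2" by simp
        ultimately have "1 \<le> norm (D \<epsilon> z)" by linarith
        hence "norm (G z) \<le> norm (F z) / 1"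
          unfolding G_def norm_divide by (intro divide_left_mono) auto
        thus ?thesis using line[OF line'] \<open>B' > B\<close> by simp
      next
        assume circ: "norm (z - of_real \<kappa>) = R"
        have nz: "norm z \<le> \<bar>\<kappa>\<bar> + R"
          using circ norm_triangle_ineq[of "z - of_real \<kappa>" "of_real \<kappa>"] by simp
        have "norm (F z) \<le> \<bar>C\<bar> * exp (\<epsilon> * Re z) * (1 + norm z)"
          using C[OF zk(1)] by (smt (verit) exp_gt_zero mult_right_mono norm_ge_zero)
        also have "\<dots> \<le> \<bar>C\<bar> * exp (\<epsilon> * Re z) * (1 + \<bar>\<kappa>\<bar> + R)"
          using nz by (intro mult_left_mono) auto
        also have "\<dots> = exp (\<epsilon> * (Re z - \<kappa>)) * (K * (1 + \<bar>\<kappa>\<bar> + R))"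
          by (simp add: K_def algebra_simps exp_diff)
        also have "\<dots> \<le> exp (\<epsilon> * (Re z - \<kappa>)) * (B' * (1 + \<epsilon>\<^sup>2 * R\<^sup>2))"
        proof (intro mult_left_mono)
          have "0 < 1 + \<epsilon>\<^sup>2 * R\<^sup>2" by (intro add_pos_nonneg) auto
          thus "K * (1 + \<bar>\<kappa>\<bar> + R) \<le> B' * (1 + \<epsilon>\<^sup>2 * R\<^sup>2)"
            using R(1) by (simp add: divide_less_eq)
        qed auto
        also have "\<dots> \<le> B' * norm (D \<epsilon> z)"
          using D_lower[OF \<open>\<epsilon> > 0\<close> zk(1)] circ \<open>B' > 0\<close> by (simp add: mult.left_commute)
        finally show ?thesis
          using Dpos[OF zk(1)] by (simp add: G_def norm_divide divide_le_eq)
      qed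
    qed
    thus ?thesis
      using Dpos[OF s] by (simp add: G_def norm_divide divide_le_eq)
  qed
  have "norm (F s) \<le> B'" if "B' > B" for B'
  proof (rule tendsto_lowerbound)
    have "((\<lambda>\<epsilon>. B' * norm (D \<epsilon> s)) \<longlongrightarrow> B' * norm (D 0 s)) (at_right 0)"
      unfolding D_def by (intro tendsto_intros)
    thus "((\<lambda>\<epsilon>. B' * norm (D \<epsilon> s)) \<longlongrightarrow> B') (at_right 0)"
      by (simp add: D_def)
    show "\<forall>\<^sub>F \<epsilon> in at_right 0. norm (F s) \<le> B' * norm (D \<epsilon> s)"
      using eventually_at_right_less[of "0::real"] by eventually_elim (use bound that in auto)
  qed auto
  thus ?thesis by (meson dense_ge)
qed

section \<open>Periodic functions of slow growth\<close>

lemma periodic_int_multiple: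
  assumes "\<And>s. s \<in> half_plane \<kappa> \<Longrightarrow> D (s + \<i> * complex_of_real \<tau>) = D s" "s \<in> half_plane \<kappa>"
  shows "D (s + \<i> * complex_of_real (of_int n * \<tau>)) = D s"
proof (induction n rule: int_induct[where k = 0])
  case base
  show ?case by simp
next
  case (step1 i)
  have "s + \<i> * complex_of_real (of_int (i + 1) * \<tau>) =
        (s + \<i> * complex_of_real (of_int i * \<tau>)) + \<i> * complex_of_real \<tau>"
    by (simp add: algebra_simps)
  thus ?case using step1 assms by (metis half_plane_shift)
next
  case (step2 i)
  have "s + \<i> * complex_of_real (of_int i * \<tau>) =
        (s + \<i> * complex_of_real (of_int (i - 1) * \<tau>)) + \<i> * complex_of_real \<tau>"
    by (simp add: algebra_simps)
  thus ?case using step2 assms by (metis half_plane_shift)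
qed

text \<open>
  Periodicity makes \<open>D\<close> a function \<open>Q\<close> of \<open>u = exp (- 2 \<pi> s / \<tau>)\<close> in the punctured unit disc, and
  \<open>Re s \<rightarrow> \<infinity>\<close> corresponds to \<open>u \<rightarrow> 0\<close>. The growth condition says \<open>Q(u) = O(\<bar>u\<bar> powr (- \<theta>))\<close> with
  \<open>\<theta> < 1\<close>, so that \<open>u Q(u) \<rightarrow> 0\<close> and the singularity at the origin is removable.
\<close>

lemma periodic_slow_growth_bounded:
  assumes hol: "D holomorphic_on half_plane 0" and "\<tau> > 0"
    and per: "\<And>s. s \<in> half_plane 0 \<Longrightarrow> D (s + \<i> * complex_of_real \<tau>) = D s"
    and growth: "\<And>s. s \<in> half_plane 1 \<Longrightarrow> norm (D s) \<le> C * exp (a * Re s)"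
    and a: "a < 2 * pi / \<tau>"
  shows "\<exists>B. \<forall>s\<in>half_plane 1. norm (D s) \<le> B"
proof -
  define c where "c = 2 * pi / \<tau>"
  have "c > 0" using \<open>\<tau> > 0\<close> by (simp add: c_def)
  have c_eq: "\<tau> = 2 * pi / c" using \<open>\<tau> > 0\<close> by (simp add: c_def)
  have D_cong: "D s = D s'"
    if s: "s \<in> half_plane 0" and s': "s' \<in> half_plane 0"
      and eq: "exp (- of_real c * s) = exp (- of_real c * s')" for s s'
  proof -
    obtain n :: int where n: "- of_real c * s = - of_real c * s' + (of_int (2 * n) * pi) * \<i>"
      using eq unfolding exp_eq by blast
    have "s = s' + \<i> * complex_of_real (of_int (- n) * \<tau>)"
      using n \<open>c > 0\<close> unfolding c_eq
      by (simp add: field_simps)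
    thus ?thesis using periodic_int_multiple[of 0 D \<tau> s' "-n", OF per s'] by metis
  qed
  have Re_log: "Re (- Ln u / of_real c) = - ln (norm u) / c" if "u \<noteq> 0" for u
    using that by (simp add: Re_divide_of_real)
  define Q where "Q = (\<lambda>u. D (- Ln u / of_real c))"
  have in_hp: "- (Ln u + z) / of_real c \<in> half_plane 0" if "u \<noteq> 0" "norm u < 1" "Re z = 0" for u z
    using that \<open>c > 0\<close> by (simp add: half_plane_def Re_divide_of_real divide_less_0_iff)
  have in_hp': "- Ln u / of_real c \<in> half_plane 0" if "u \<noteq> 0" "norm u < 1" for u
    using in_hp[of u 0] that by simp
  \<comment> \<open>the periodicity makes the branch cut of the logarithm invisible\<close>
  have Q_alt: "Q u = D (- (Ln (- u) + \<i> * pi) / of_real c)" if u: "u \<noteq> 0" "norm u < 1" for u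
    unfolding Q_def
    by (rule D_cong) (use in_hp'[OF u] in_hp[of "-u" "\<i> * pi"] u \<open>c > 0\<close> in
        \<open>auto simp: exp_add exp_diff\<close>)
  have holQ: "Q holomorphic_on ball 0 1 - {0}"
  proof -
    let ?S1 = "(ball 0 1 - {0}) - \<real>\<^sub>\<le>\<^sub>0 :: complex set"
    let ?S2 = "(ball 0 1 - {0}) - \<real>\<^sub>\<ge>\<^sub>0 :: complex set"
    have "(\<lambda>u. D (- Ln u / of_real c)) holomorphic_on ?S1"
    proof (rule holomorphic_on_compose_gen[OF _ hol, unfolded o_def])
      show "(\<lambda>u. - Ln u / of_real c) holomorphic_on ?S1"
        using \<open>c > 0\<close> by (intro holomorphic_intros) auto
      show "(\<lambda>u. - Ln u / of_real c) ` ?S1 \<subseteq> half_plane 0"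
        by (rule image_subsetI, rule in_hp') auto
    qed
    hence "Q holomorphic_on ?S1" by (simp add: Q_def)
    moreover have "(\<lambda>u. D (- (Ln (- u) + \<i> * pi) / of_real c)) holomorphic_on ?S2"
    proof (rule holomorphic_on_compose_gen[OF _ hol, unfolded o_def])
      show "(\<lambda>u. - (Ln (- u) + \<i> * pi) / of_real c) holomorphic_on ?S2"
        using \<open>c > 0\<close> by (intro holomorphic_intros) auto
      show "(\<lambda>u. - (Ln (- u) + \<i> * pi) / of_real c) ` ?S2 \<subseteq> half_plane 0"
        by (rule image_subsetI, rule in_hp) auto
    qed
    hence "Q holomorphic_on ?S2"
      by (rule holomorphic_transform) (use Q_alt in auto)
    ultimately have "Q holomorphic_on (?S1 \<union> ?S2)"
      by (intro holomorphic_on_Un open_Diff open_ball closed_singleton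
          closed_nonpos_Reals_complex closed_nonneg_Reals_complex) auto
    also have "?S1 \<union> ?S2 = ball 0 1 - {0}"
      by (auto simp: complex_nonpos_Reals_iff complex_nonneg_Reals_iff complex_eq_iff)
    finally show ?thesis .
  qed
  have "((\<lambda>u. (u - 0) * Q u) \<longlongrightarrow> 0) (at 0)"
  proof (rule Lim_null_comparison)
    have "\<forall>\<^sub>F u::complex in at 0. norm u < exp (- c) \<and> u \<noteq> 0"
      unfolding eventually_at by (rule exI[of _ "exp (- c)"]) (auto simp: dist_norm)
    thus "\<forall>\<^sub>F u in at 0. norm ((u - 0) * Q u) \<le> C * norm u powr (1 - a / c)"
    proof eventually_elim
      case (elim u)
      have "ln (norm u) < - c"
        using elim by (metis exp_gt_zero ln_exp ln_less_cancel_iff zero_less_norm_iff)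
      hence "- Ln u / of_real c \<in> half_plane 1"
        using elim \<open>c > 0\<close> by (simp add: half_plane_def Re_log field_simps)
      hence "norm (Q u) \<le> C * exp (a * (- ln (norm u) / c))"
        using growth Re_log elim unfolding Q_def by metis
      hence "norm u * norm (Q u) \<le> norm u * (C * exp (a * (- ln (norm u) / c)))"
        by (rule mult_left_mono) simp
      also have "\<dots> = C * norm u powr (1 - a / c)"
        using elim by (simp add: powr_def left_diff_distrib exp_diff exp_minus field_simps)
      finally show ?case by (simp add: norm_mult)
    qed
    have "((\<lambda>u. norm u powr (1 - a / c)) \<longlongrightarrow> 0) (at (0::complex))"
    proof (rule tendsto_zero_powrI)
      show "((\<lambda>u::complex. norm u) \<longlongrightarrow> 0) (at 0)" by (rule tendsto_norm_zero) (rule tendsto_ident_at)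
      show "((\<lambda>u::complex. 1 - a / c) \<longlongrightarrow> 1 - a / c) (at 0)" by (rule tendsto_const)
      show "0 < 1 - a / c" using a \<open>c > 0\<close> by (simp add: c_def[symmetric])
    qed auto
    thus "((\<lambda>u. C * norm u powr (1 - a / c)) \<longlongrightarrow> 0) (at (0::complex))"
      by (rule tendsto_mult_right_zero)
  qed
  then obtain g where g: "g holomorphic_on ball 0 1" "\<And>u. u \<in> ball 0 1 - {0} \<Longrightarrow> g u = Q u"
    using holomorphic_on_extend_lim[OF holQ] by auto
  have "continuous_on (cball 0 (exp (- c))) g"
    using \<open>c > 0\<close> by (intro holomorphic_on_imp_continuous_on holomorphic_on_subset[OF g(1)]) (simp add: cball_subset_ball_iff)
  hence "bounded (g ` cball 0 (exp (- c)))"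
    using compact_continuous_image compact_imp_bounded compact_cball by blast
  then obtain B where B: "\<And>u. u \<in> cball 0 (exp (- c)) \<Longrightarrow> norm (g u) \<le> B"
    unfolding bounded_iff by blast
  have "norm (D s) \<le> B" if s: "s \<in> half_plane 1" for s
  proof -
    define u where "u = exp (- of_real c * s)"
    have "c \<le> c * Re s"
      using s \<open>c > 0\<close> by (simp add: half_plane_def)
    hence nu: "norm u \<le> exp (- c)" by (simp add: u_def)
    also have "\<dots> < 1" using \<open>c > 0\<close> by simp
    finally have u: "u \<noteq> 0" "norm u < 1" by (simp_all add: u_def)
    have "D s = Q u"
      unfolding Q_def using s in_hp'[OF u] \<open>c > 0\<close> u
      by (intro D_cong) (auto simp: half_plane_def u_def)
    thus ?thesis using g(2)[of u] B[of u] u nu by simp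
  qed
  thus ?thesis by blast
qed

section \<open>Periodization by summation over translates\<close>

definition int_weight :: "int \<Rightarrow> real" where
  "int_weight n = 1 / (1 + (of_int n)\<^sup>2)"

lemma int_weight_pos: "int_weight n > 0"
  unfolding int_weight_def by (intro divide_pos_pos add_pos_nonneg) auto

lemma int_weight_le_1: "int_weight n \<le> 1"
  by (simp add: int_weight_def divide_le_eq_1 add_pos_nonneg)

lemma summable_int_weight: "int_weight summable_on UNIV"
proof -
  have "summable (\<lambda>n. int_weight (int n))"
  proof (rule summable_comparison_test')
    show "summable (\<lambda>n. inverse (real n ^ 2))"
      by (rule inverse_power_summable) simp
    show "norm (int_weight (int n)) \<le> inverse (real n ^ 2)" if "n \<ge> 1" for n
      using that by (simp add: int_weight_def field_simps add_pos_nonneg)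
  qed
  hence nat: "(\<lambda>n. int_weight (int n)) summable_on UNIV"
    by (rule summable_nonneg_imp_summable_on) (simp add: int_weight_pos less_imp_le)
  have pos: "int_weight summable_on range int"
    using nat by (subst summable_on_reindex) (auto simp: inj_on_def o_def)
  have neg: "int_weight summable_on range (\<lambda>n. - int n)"
    using nat by (subst summable_on_reindex) (auto simp: inj_on_def o_def int_weight_def)
  have "range int \<union> range (\<lambda>n. - int n) = UNIV"
    by (auto simp: image_iff) (metis int_cases2)
  thus ?thesis using summable_on_union[OF pos neg] by simp
qed

lemma int_weight_dominated:
  fixes a :: "int \<Rightarrow> 'a :: banach"
  assumes "\<And>n. norm (a n) \<le> C * int_weight n"
  shows "a summable_on UNIV" "norm (infsum a UNIV) \<le> C * infsum int_weight UNIV"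
proof -
  have W: "((\<lambda>n. C * int_weight n) has_sum (C * infsum int_weight UNIV)) UNIV"
    using summable_int_weight by (intro has_sum_cmult_right) auto
  have "(\<lambda>n. norm (a n)) summable_on UNIV"
    by (rule summable_on_comparison_test[OF has_sum_imp_summable[OF W]]) (use assms in auto)
  thus *: "a summable_on UNIV" by (rule abs_summable_summable)
  show "norm (infsum a UNIV) \<le> C * infsum int_weight UNIV"
    by (rule norm_infsum_le[OF has_sum_infsum[OF *] W]) (use assms in auto)
qed

definition periodization :: "real \<Rightarrow> (complex \<Rightarrow> complex) \<Rightarrow> complex \<Rightarrow> complex" where
  "periodization \<tau> F s = (\<Sum>\<^sub>\<infinity>n\<in>UNIV. F (s + \<i> * complex_of_real (of_int n * \<tau>)))"

lemma periodization_periodic: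
  "periodization \<tau> F (s + \<i> * complex_of_real \<tau>) = periodization \<tau> F s"
proof -
  have "periodization \<tau> F (s + \<i> * complex_of_real \<tau>) =
        (\<Sum>\<^sub>\<infinity>n\<in>UNIV. F (s + \<i> * complex_of_real (of_int (n + 1) * \<tau>)))"
    unfolding periodization_def by (simp add: algebra_simps)
  also have "\<dots> = periodization \<tau> F s"
    unfolding periodization_def
    by (rule infsum_reindex_bij_betw[of "\<lambda>n. n + 1" UNIV UNIV
          "\<lambda>n. F (s + \<i> * complex_of_real (of_int n * \<tau>))"])
      (rule bij_betwI[of _ _ _ "\<lambda>n. n - 1"], auto)
  finally show ?thesis .
qed

text \<open>
  The domination makes the series converge uniformly near every point, so that analyticity passes to the sum.
\<close>

lemma periodization_holomorphic:
  assumes hol: "F holomorphic_on A"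
    and inv: "\<And>s t. s \<in> A \<Longrightarrow> s + \<i> * complex_of_real t \<in> A"
    and dom: "\<And>s. s \<in> A \<Longrightarrow> \<exists>r>0. \<exists>C. cball s r \<subseteq> A \<and>
       (\<forall>w\<in>cball s r. \<forall>n. norm (F (w + \<i> * complex_of_real (of_int n * \<tau>))) \<le> C * int_weight n)"
  shows "periodization \<tau> F holomorphic_on A"
proof -
  let ?a = "\<lambda>n w. F (w + \<i> * complex_of_real (of_int n * \<tau>))"
  have hola: "?a n holomorphic_on A" for n
    by (rule holomorphic_on_compose_gen[OF _ hol, unfolded o_def])
      (auto intro!: holomorphic_intros image_subsetI inv simp del: of_real_mult)
  have "\<exists>r>0. periodization \<tau> F holomorphic_on ball s r" if "s \<in> A" for s
  proof -
    obtain r C where r: "r > 0" "cball s r \<subseteq> A"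
      and C: "\<And>w n. w \<in> cball s r \<Longrightarrow> norm (?a n w) \<le> C * int_weight n"
      using dom[OF \<open>s \<in> A\<close>] by blast
    have lim: "uniform_limit (cball s r) (\<lambda>X w. \<Sum>n\<in>X. ?a n w) (\<lambda>w. \<Sum>\<^sub>\<infinity>n\<in>UNIV. ?a n w)
       (finite_subsets_at_top UNIV)"
      using C summable_on_cmult_right[OF summable_int_weight]
      by (intro Weierstrass_m_test_general) auto
    have cont: "continuous_on (cball s r) (\<lambda>w. \<Sum>n\<in>X. ?a n w) \<and>
        (\<lambda>w. \<Sum>n\<in>X. ?a n w) holomorphic_on ball s r" for X
    proof -
      have "(\<lambda>w. \<Sum>n\<in>X. ?a n w) holomorphic_on cball s r"
        using holomorphic_on_subset[OF hola r(2)] by (rule holomorphic_on_sum)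
      thus ?thesis
        using holomorphic_on_imp_continuous_on holomorphic_on_subset ball_subset_cball by blast
    qed
    have "(\<lambda>w. \<Sum>\<^sub>\<infinity>n\<in>UNIV. ?a n w) holomorphic_on ball s r"
      by (rule holomorphic_uniform_limit[OF _ lim]) (use cont in auto)
    thus ?thesis using r unfolding periodization_def[abs_def] by blast
  qed
  thus ?thesis
    by (intro analytic_imp_holomorphic) (simp add: analytic_on_def)
qed

section \<open>A kernel whose translates sum to a constant\<close>

definition sinhc :: "complex \<Rightarrow> complex" where
  "sinhc z = (if z = 0 then 1 else sinh z / z)"

text \<open>
  Along the imaginary axis this is the Jackson kernel \<open>(sin (\<delta> t) / (\<delta> t))\<^sup>4\<close>. The fourth power
  makes the sum of the translates converge even with the extra factor \<open>\<bar>n\<bar>\<close>, and makes the values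
  on the imaginary axis nonnegative; a small \<open>\<delta>\<close> makes the exponential growth as slow as desired.
\<close>

definition jackson_kernel :: "real \<Rightarrow> complex \<Rightarrow> complex" where
  "jackson_kernel \<delta> s = sinhc (of_real \<delta> * s) ^ 4"

lemma sinhc_holomorphic: "sinhc holomorphic_on UNIV"
proof -
  have "deriv sinh (0::complex) = 1"
    by (rule DERIV_imp_deriv) (auto intro!: derivative_eq_intros)
  moreover have "(sinh :: complex \<Rightarrow> complex) holomorphic_on UNIV"
    unfolding sinh_def scaleR_conv_of_real by (intro holomorphic_intros)
  ultimately show ?thesis
    using pole_lemma[of sinh UNIV 0] by (simp add: sinhc_def[abs_def] if_distrib cong: if_cong)
qed

lemma norm_sinh_le: "norm (sinh z) \<le> exp \<bar>Re z\<bar>" for z :: complex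
proof -
  have "norm (sinh z) \<le> (norm (exp z) + norm (exp (- z))) / 2"
    using norm_triangle_ineq4[of "exp z" "exp (- z)"] by (simp add: sinh_def)
  also have "\<dots> \<le> exp \<bar>Re z\<bar>" by (auto simp: abs_if)
  finally show ?thesis .
qed

lemma norm_cosh_le: "norm (cosh z) \<le> exp \<bar>Re z\<bar>" for z :: complex
proof -
  have "norm (cosh z) \<le> (norm (exp z) + norm (exp (- z))) / 2"
    using norm_triangle_ineq[of "exp z" "exp (- z)"] by (simp add: cosh_def)
  also have "\<dots> \<le> exp \<bar>Re z\<bar>" by (auto simp: abs_if)
  finally show ?thesis .
qed

text \<open>
  Two estimates are combined: \<open>\<bar>sinh z\<bar> \<le> \<bar>z\<bar> exp \<bar>Re z\<bar>\<close> by the mean value inequality, which is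
  needed near the origin, and \<open>\<bar>sinh z\<bar> \<le> exp \<bar>Re z\<bar>\<close>, which gives the decay in \<open>Im z\<close>.
\<close>

lemma sinhc_bound: "(1 + (Im z)\<^sup>2) * (norm (sinhc z))\<^sup>2 \<le> 2 * exp (2 * \<bar>Re z\<bar>)"
proof (cases "z = 0")
  case False
  let ?E = "exp \<bar>Re z\<bar>"
  have "norm (sinh z - sinh 0) \<le> ?E * norm (z - 0)"
  proof (rule field_differentiable_bound[where f' = cosh])
    show "convex {w. - \<bar>Re z\<bar> \<le> Re w \<and> Re w \<le> \<bar>Re z\<bar>}"
      unfolding Collect_conj_eq
      by (intro convex_Int convex_halfspace_Re_le convex_halfspace_Re_ge)
    fix w assume "w \<in> {w. - \<bar>Re z\<bar> \<le> Re w \<and> Re w \<le> \<bar>Re z\<bar>}"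
    hence "\<bar>Re w\<bar> \<le> \<bar>Re z\<bar>" by auto
    thus "norm (cosh w) \<le> ?E" using norm_cosh_le[of w] by (meson exp_le_cancel_iff order_trans)
  qed (auto intro!: derivative_eq_intros)
  hence 1: "norm (sinhc z) \<le> ?E"
    using False by (simp add: sinhc_def norm_divide divide_le_eq)
  have "\<bar>Im z\<bar> * norm (sinhc z) \<le> norm z * norm (sinhc z)"
    by (intro mult_right_mono abs_Im_le_cmod) auto
  also have "\<dots> = norm (sinh z)" using False by (simp add: sinhc_def norm_divide)
  finally have 2: "\<bar>Im z\<bar> * norm (sinhc z) \<le> ?E" using norm_sinh_le[of z] by linarith
  have "(norm (sinhc z))\<^sup>2 + (\<bar>Im z\<bar> * norm (sinhc z))\<^sup>2 \<le> ?E\<^sup>2 + ?E\<^sup>2"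
    using 1 2 by (intro add_mono power_mono) auto
  thus ?thesis unfolding exp_double by (simp add: power_mult_distrib algebra_simps)
qed (simp add: sinhc_def)

lemma jackson_kernel_holomorphic: "jackson_kernel \<delta> holomorphic_on A"
proof -
  have "(\<lambda>s. sinhc (of_real \<delta> * s)) holomorphic_on A"
    by (rule holomorphic_on_compose_gen[OF _ sinhc_holomorphic, unfolded o_def])
      (auto intro!: holomorphic_intros)
  thus ?thesis unfolding jackson_kernel_def[abs_def] by (intro holomorphic_intros)
qed

text \<open>
  For \<open>s\<close> in a fixed horizontal strip, \<open>1 + n\<^sup>2\<close> is at most a constant times
  \<open>1 + (\<delta> (Im s + n \<tau>))\<^sup>2\<close>, so the decay in \<open>Im s\<close> turns into decay in \<open>n\<close>. The square of the
  weight leaves one factor to compensate for a linear growth in \<open>n\<close>.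
\<close>

lemma jackson_kernel_decay:
  assumes "\<delta> > 0" "\<tau> > 0"
  obtains C where "C \<ge> 0" "\<And>s n. \<bar>Im s\<bar> \<le> T \<Longrightarrow>
    norm (jackson_kernel \<delta> (s + \<i> * complex_of_real (of_int n * \<tau>)))
      \<le> C * exp (4 * \<delta> * \<bar>Re s\<bar>) * (int_weight n)\<^sup>2"
proof -
  define a b where "a = 2 * T\<^sup>2 / \<tau>\<^sup>2" and "b = 2 / (\<tau>\<^sup>2 * \<delta>\<^sup>2)"
  have "a \<ge> 0" "b \<ge> 0" by (simp_all add: a_def b_def)
  define K where "K = 1 + a + b"
  have "norm (jackson_kernel \<delta> (s + \<i> * complex_of_real (of_int n * \<tau>)))
      \<le> (4 * K\<^sup>2) * exp (4 * \<delta> * \<bar>Re s\<bar>) * (int_weight n)\<^sup>2" if "\<bar>Im s\<bar> \<le> T" for s n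
  proof -
    define u where "u = Im s + of_int n * \<tau>"
    define X where "X = norm (sinhc (of_real \<delta> * (s + \<i> * complex_of_real (of_int n * \<tau>))))"
    have "(of_int n * \<tau>)\<^sup>2 = (u - Im s)\<^sup>2" by (simp add: u_def)
    also have "\<dots> \<le> 2 * u\<^sup>2 + 2 * (Im s)\<^sup>2"
      using zero_le_power2[of "u + Im s"] by (simp add: power2_eq_square algebra_simps)
    also have "\<dots> \<le> 2 * u\<^sup>2 + 2 * T\<^sup>2"
      using that abs_le_square_iff[of "Im s" T] by auto
    finally have "(of_int n)\<^sup>2 \<le> 2 * u\<^sup>2 / \<tau>\<^sup>2 + a"
      using \<open>\<tau> > 0\<close> by (simp add: a_def power_mult_distrib field_simps)
    moreover have "b * (\<delta> * u)\<^sup>2 = 2 * u\<^sup>2 / \<tau>\<^sup>2"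
      using assms by (simp add: b_def power_mult_distrib)
    moreover have "K * (1 + (\<delta> * u)\<^sup>2) = 1 + a + b + (1 + a) * (\<delta> * u)\<^sup>2 + b * (\<delta> * u)\<^sup>2"
      by (simp add: K_def algebra_simps)
    moreover have "(1 + a) * (\<delta> * u)\<^sup>2 \<ge> 0" using \<open>a \<ge> 0\<close> by simp
    ultimately have n: "1 + (of_int n)\<^sup>2 \<le> K * (1 + (\<delta> * u)\<^sup>2)"
      using \<open>b \<ge> 0\<close> by linarith
    have "K > 0" unfolding K_def using \<open>a \<ge> 0\<close> \<open>b \<ge> 0\<close> by linarith
    have "(1 + (of_int n)\<^sup>2) * X\<^sup>2 \<le> K * ((1 + (\<delta> * u)\<^sup>2) * X\<^sup>2)"
      using mult_right_mono[OF n zero_le_power2[of X]] by (simp add: mult.assoc)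
    also have "\<dots> \<le> K * (2 * exp (2 * \<bar>\<delta> * Re s\<bar>))"
      using sinhc_bound[of "of_real \<delta> * (s + \<i> * complex_of_real (of_int n * \<tau>))"] \<open>K > 0\<close>
      by (intro mult_left_mono) (auto simp: X_def u_def)
    finally have "X\<^sup>2 \<le> 2 * K * exp (2 * \<delta> * \<bar>Re s\<bar>) * int_weight n"
      using \<open>\<delta> > 0\<close> int_weight_pos[of n] unfolding int_weight_def
      by (simp add: abs_mult field_simps add_pos_nonneg)
    hence "(X\<^sup>2)\<^sup>2 \<le> (2 * K * exp (2 * \<delta> * \<bar>Re s\<bar>) * int_weight n)\<^sup>2"
      by (rule power_mono) simp
    also have "\<dots> = (4 * K\<^sup>2) * exp (4 * \<delta> * \<bar>Re s\<bar>) * (int_weight n)\<^sup>2"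
    proof -
      have "exp (4 * \<delta> * \<bar>Re s\<bar>) = (exp (2 * \<delta> * \<bar>Re s\<bar>))\<^sup>2"
        by (simp flip: exp_double)
      thus ?thesis by (simp add: power_mult_distrib)
    qed
    finally show ?thesis by (simp add: jackson_kernel_def X_def norm_power)
  qed
  thus ?thesis by (intro that[of "4 * K\<^sup>2"]) auto
qed

lemma exists_shift_to_period:
  assumes "\<tau> > 0"
  obtains n :: int where "0 \<le> Im (s + \<i> * complex_of_real (of_int n * \<tau>))"
    "Im (s + \<i> * complex_of_real (of_int n * \<tau>)) \<le> \<tau>"
    "\<bar>of_int n\<bar> \<le> 1 + \<bar>Im s\<bar> / \<tau>"
proof (rule that[of "- \<lfloor>Im s / \<tau>\<rfloor>"])
  define m where "m = \<lfloor>Im s / \<tau>\<rfloor>"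
  have m: "of_int m \<le> Im s / \<tau>" "Im s / \<tau> < of_int m + 1"
    unfolding m_def by linarith+
  have "of_int m * \<tau> \<le> Im s" "Im s \<le> (of_int m + 1) * \<tau>"
    using m \<open>\<tau> > 0\<close> by (simp_all add: field_simps)
  thus "0 \<le> Im (s + \<i> * complex_of_real (of_int (- \<lfloor>Im s / \<tau>\<rfloor>) * \<tau>))"
    "Im (s + \<i> * complex_of_real (of_int (- \<lfloor>Im s / \<tau>\<rfloor>) * \<tau>)) \<le> \<tau>"
    by (simp_all add: m_def[symmetric] algebra_simps)
  have "\<bar>of_int m\<bar> \<le> 1 + \<bar>Im s / \<tau>\<bar>"
    using m by linarith
  thus "\<bar>of_int (- \<lfloor>Im s / \<tau>\<rfloor>)\<bar> \<le> 1 + \<bar>Im s\<bar> / \<tau>"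
    using \<open>\<tau> > 0\<close> by (simp add: m_def[symmetric] abs_divide)
qed

text \<open>
  The sum of the translates is entire, has period \<open>i \<tau>\<close> and grows more slowly than
  \<open>exp (2 \<pi> \<bar>Re s\<bar> / \<tau>)\<close>. It is therefore bounded in the right and in the left half-plane and
  constant by Liouville's theorem. At the origin all terms are nonnegative and the one with
  \<open>n = 0\<close> is \<open>1\<close>, so the constant is not zero.
\<close>

lemma jackson_kernel_mean_const:
  assumes "\<delta> > 0" "\<tau> > 0" "4 * \<delta> < 2 * pi / \<tau>"
  obtains S where "S \<noteq> 0" "\<And>s. periodization \<tau> (jackson_kernel \<delta>) s = S"
proof -
  define K where "K = periodization \<tau> (jackson_kernel \<delta>)"
  have hol: "K holomorphic_on UNIV"
    unfolding K_def
  proof (rule periodization_holomorphic[OF jackson_kernel_holomorphic])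
    fix s :: complex
    obtain C where C: "C \<ge> 0" "\<And>w n. \<bar>Im w\<bar> \<le> \<bar>Im s\<bar> + 1 \<Longrightarrow>
        norm (jackson_kernel \<delta> (w + \<i> * complex_of_real (of_int n * \<tau>)))
          \<le> C * exp (4 * \<delta> * \<bar>Re w\<bar>) * (int_weight n)\<^sup>2"
      using jackson_kernel_decay[OF assms(1,2)] by metis
    have "norm (jackson_kernel \<delta> (w + \<i> * complex_of_real (of_int n * \<tau>)))
          \<le> (C * exp (4 * \<delta> * (\<bar>Re s\<bar> + 1))) * int_weight n" if "w \<in> cball s 1" for w n
    proof -
      have "norm (w - s) \<le> 1" using that by (simp add: dist_norm norm_minus_commute)
      hence "\<bar>Re w\<bar> \<le> \<bar>Re s\<bar> + 1" "\<bar>Im w\<bar> \<le> \<bar>Im s\<bar> + 1"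
        using abs_Re_le_cmod[of "w - s"] abs_Im_le_cmod[of "w - s"] by auto
      hence "norm (jackson_kernel \<delta> (w + \<i> * complex_of_real (of_int n * \<tau>)))
          \<le> C * exp (4 * \<delta> * \<bar>Re w\<bar>) * (int_weight n)\<^sup>2" by (intro C)
      also have "\<dots> \<le> C * exp (4 * \<delta> * (\<bar>Re s\<bar> + 1)) * int_weight n"
        using C(1) \<open>\<bar>Re w\<bar> \<le> \<bar>Re s\<bar> + 1\<close> assms(1) int_weight_pos[of n] int_weight_le_1[of n]
        by (intro mult_mono) (auto simp: power2_eq_square mult_left_le)
      finally show ?thesis .
    qed
    thus "\<exists>r>0. \<exists>C. cball s r \<subseteq> UNIV \<and> (\<forall>w\<in>cball s r. \<forall>n.
        norm (jackson_kernel \<delta> (w + \<i> * complex_of_real (of_int n * \<tau>))) \<le> C * int_weight n)"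
      by (intro exI[of _ 1] conjI exI[of _ "C * exp (4 * \<delta> * (\<bar>Re s\<bar> + 1))"]) auto
  qed auto
  have per: "K (s + \<i> * complex_of_real \<tau>) = K s" for s
    unfolding K_def by (rule periodization_periodic)
  have per_int: "K (s + \<i> * complex_of_real (of_int n * \<tau>)) = K s" for s n
    by (rule periodic_int_multiple[of "Re s - 1"]) (auto simp: per half_plane_def)
  obtain C where C: "C \<ge> 0" "\<And>w n. \<bar>Im w\<bar> \<le> \<tau> \<Longrightarrow>
      norm (jackson_kernel \<delta> (w + \<i> * complex_of_real (of_int n * \<tau>)))
        \<le> C * exp (4 * \<delta> * \<bar>Re w\<bar>) * (int_weight n)\<^sup>2"
    using jackson_kernel_decay[OF assms(1,2)] by metis
  define C' where "C' = C * infsum int_weight UNIV"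
  have dom: "norm (jackson_kernel \<delta> (w + \<i> * complex_of_real (of_int n * \<tau>)))
        \<le> (C * exp (4 * \<delta> * \<bar>Re w\<bar>)) * int_weight n" if "\<bar>Im w\<bar> \<le> \<tau>" for w n
  proof -
    have "C * exp (4 * \<delta> * \<bar>Re w\<bar>) * (int_weight n)\<^sup>2 \<le> C * exp (4 * \<delta> * \<bar>Re w\<bar>) * int_weight n"
      using C(1) int_weight_pos[of n] int_weight_le_1[of n]
      by (intro mult_left_mono) (auto simp: power2_eq_square mult_left_le)
    with C(2)[OF that, of n] show ?thesis by linarith
  qed
  have growth: "norm (K s) \<le> C' * exp (4 * \<delta> * \<bar>Re s\<bar>)" for s
  proof -
    obtain n where n: "0 \<le> Im (s + \<i> * complex_of_real (of_int n * \<tau>))"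
        "Im (s + \<i> * complex_of_real (of_int n * \<tau>)) \<le> \<tau>"
      using exists_shift_to_period[OF \<open>\<tau> > 0\<close>] by metis
    define w where "w = s + \<i> * complex_of_real (of_int n * \<tau>)"
    have "norm (K w) \<le> (C * exp (4 * \<delta> * \<bar>Re w\<bar>)) * infsum int_weight UNIV"
      unfolding K_def periodization_def
      by (rule int_weight_dominated(2), rule dom) (use n in \<open>simp add: w_def\<close>)
    moreover have "K w = K s" unfolding w_def by (rule per_int)
    moreover have "Re w = Re s" by (simp add: w_def)
    ultimately show ?thesis by (simp add: C'_def mult_ac)
  qed
  obtain B1 where B1: "\<And>s. s \<in> half_plane 1 \<Longrightarrow> norm (K s) \<le> B1"
  proof -
    have "\<exists>B. \<forall>s\<in>half_plane 1. norm (K s) \<le> B"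
    proof (rule periodic_slow_growth_bounded[OF _ \<open>\<tau> > 0\<close> _ _ assms(3)])
      show "norm (K s) \<le> C' * exp (4 * \<delta> * Re s)" if "s \<in> half_plane 1" for s
        using growth[of s] that by (simp add: half_plane_def)
    qed (use holomorphic_on_subset[OF hol] per in auto)
    thus thesis using that by blast
  qed
  \<comment> \<open>the left half-plane, by reflection\<close>
  obtain B2 where B2: "\<And>s. s \<in> half_plane 1 \<Longrightarrow> norm (K (- s)) \<le> B2"
  proof -
    have "\<exists>B. \<forall>s\<in>half_plane 1. norm (K (- s)) \<le> B"
    proof (rule periodic_slow_growth_bounded[OF _ \<open>\<tau> > 0\<close> _ _ assms(3)])
      show "norm (K (- s)) \<le> C' * exp (4 * \<delta> * Re s)" if "s \<in> half_plane 1" for s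
        using growth[of "- s"] that by (simp add: half_plane_def)
      show "K (- (s + \<i> * complex_of_real \<tau>)) = K (- s)" for s
        using per[of "- (s + \<i> * complex_of_real \<tau>)"] by simp
      show "(\<lambda>s. K (- s)) holomorphic_on half_plane 0"
        by (rule holomorphic_on_compose_gen[OF _ hol, unfolded o_def]) (auto intro: holomorphic_intros)
    qed
    thus thesis using that by blast
  qed
  have "norm (K s) \<le> max (max B1 B2) (C' * exp (4 * \<delta>))" for s
  proof -
    consider "s \<in> half_plane 1" | "- s \<in> half_plane 1" | "\<bar>Re s\<bar> \<le> 1"
      by (force simp: half_plane_def)
    thus ?thesis
    proof cases
      case 3
      have "C' \<ge> 0"
        unfolding C'_def using C(1) infsum_nonneg[of UNIV int_weight] int_weight_pos
        by (simp add: less_imp_le)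
      hence "C' * exp (4 * \<delta> * \<bar>Re s\<bar>) \<le> C' * exp (4 * \<delta>)"
        using 3 assms(1) by (intro mult_left_mono) auto
      thus ?thesis using growth[of s] by linarith
    qed (use B1[of s] B2[of "-s"] in auto)
  qed
  hence "bounded (range K)" unfolding bounded_iff by blast
  then obtain S where S: "\<And>s. K s = S"
    using Liouville_theorem[OF hol] by (auto simp: constant_on_def)
  have "S \<noteq> 0"
  proof -
    \<comment> \<open>the values of the kernel on the imaginary axis\<close>
    define r where "r = (\<lambda>n::int. if n = 0 then 1 else (sin (\<delta> * (of_int n * \<tau>)) / (\<delta> * (of_int n * \<tau>))) ^ 4)"
    have r: "jackson_kernel \<delta> (0 + \<i> * complex_of_real (of_int n * \<tau>)) = of_real (r n)" for n
    proof (cases "n = 0")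
      case False
      have "sinh (\<i> * of_real y) = \<i> * of_real (sin y)" for y :: real
        by (simp add: sinh_def sin_exp_eq' sin_of_real[symmetric] scaleR_conv_of_real)
      from this[of "\<delta> * (of_int n * \<tau>)"]
      have "sinhc (of_real \<delta> * (0 + \<i> * complex_of_real (of_int n * \<tau>))) =
         of_real (sin (\<delta> * (of_int n * \<tau>)) / (\<delta> * (of_int n * \<tau>)))"
        using False assms(1,2) by (simp add: sinhc_def mult_ac)
      thus ?thesis using False unfolding jackson_kernel_def r_def by (simp del: of_real_divide of_real_mult)
    qed (simp add: jackson_kernel_def r_def sinhc_def)
    have "(\<lambda>n. jackson_kernel \<delta> (0 + \<i> * complex_of_real (of_int n * \<tau>))) summable_on UNIV"
      by (rule int_weight_dominated(1), rule dom) (use assms(2) in simp)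
    hence "((\<lambda>n. complex_of_real (r n)) has_sum S) UNIV"
      using S[of 0] unfolding K_def periodization_def r by (metis has_sum_infsum)
    hence sum: "(r has_sum Re S) UNIV"
      using has_sum_Re by fastforce
    have "sum r {0} \<le> Re S"
      by (rule finite_sum_le_has_sum[OF sum]) (auto simp: r_def)
    thus ?thesis by (auto simp: r_def)
  qed
  with S show thesis unfolding K_def by (intro that)
qed

section \<open>Approximation by a periodic function\<close>

lemma iterated_increment_bound:
  assumes "\<And>s. s \<in> half_plane \<kappa> \<Longrightarrow> norm (f (s + \<i> * complex_of_real \<tau>) - f s) \<le> M" "s \<in> half_plane \<kappa>"
  shows "norm (f (s + \<i> * complex_of_real (of_int n * \<tau>)) - f s) \<le> \<bar>of_int n\<bar> * M"
proof -
  have *: "norm (f (w + \<i> * complex_of_real (of_nat k * \<tau>)) - f w) \<le> of_nat k * M"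
    if "w \<in> half_plane \<kappa>" for w k
  proof (induction k)
    case (Suc k)
    define v where "v = w + \<i> * complex_of_real (of_nat k * \<tau>)"
    have "v \<in> half_plane \<kappa>" using that unfolding v_def by (subst half_plane_shift)
    hence "norm (f (v + \<i> * complex_of_real \<tau>) - f v) \<le> M" by (rule assms(1))
    moreover have "norm (f v - f w) \<le> of_nat k * M" using Suc by (simp add: v_def)
    moreover have "norm (f (v + \<i> * complex_of_real \<tau>) - f w)
        \<le> norm (f (v + \<i> * complex_of_real \<tau>) - f v) + norm (f v - f w)"
      using norm_triangle_ineq[of "f (v + \<i> * complex_of_real \<tau>) - f v" "f v - f w"] by simp
    ultimately have "norm (f (v + \<i> * complex_of_real \<tau>) - f w) \<le> of_nat (Suc k) * M"
      by (simp add: ring_distribs)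
    moreover have "w + \<i> * complex_of_real (of_nat (Suc k) * \<tau>) = v + \<i> * complex_of_real \<tau>"
      by (simp add: v_def algebra_simps)
    ultimately show ?case by (simp only:)
  qed simp
  show ?thesis
  proof (cases n)
    case (nonneg k)
    thus ?thesis using *[OF assms(2), of k] by simp
  next
    case (neg k)
    define w where "w = s + \<i> * complex_of_real (of_int n * \<tau>)"
    have "w + \<i> * complex_of_real (of_nat (Suc k) * \<tau>) = s"
      by (simp add: w_def neg algebra_simps)
    moreover have "w \<in> half_plane \<kappa>" using assms(2) unfolding w_def by (subst half_plane_shift)
    ultimately have "norm (f s - f w) \<le> of_nat (Suc k) * M" using *[of w "Suc k"] by (simp only:)
    moreover have "\<bar>of_int n :: real\<bar> = of_nat (Suc k)" by (simp add: neg)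
    ultimately show ?thesis unfolding w_def[symmetric] by (simp only: norm_minus_commute)
  qed
qed

definition bounded_on_strips :: "(complex \<Rightarrow> complex) \<Rightarrow> bool" where
  "bounded_on_strips f \<longleftrightarrow> (\<forall>\<kappa>>0. \<forall>K. \<exists>M. \<forall>s. \<kappa> \<le> Re s \<and> Re s \<le> K \<longrightarrow> norm (f s) \<le> M)"

lemma bounded_on_stripsE:
  assumes "bounded_on_strips f" "\<kappa> > 0"
  obtains M where "M \<ge> 0" "\<And>s. \<kappa> \<le> Re s \<Longrightarrow> Re s \<le> K \<Longrightarrow> norm (f s) \<le> M"
proof -
  obtain M where M: "\<And>s. \<kappa> \<le> Re s \<Longrightarrow> Re s \<le> K \<Longrightarrow> norm (f s) \<le> M"
    using assms unfolding bounded_on_strips_def by meson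
  show thesis
    by (rule that[of "max M 0"]) (use M in \<open>auto simp: le_max_iff_disj\<close>)
qed

text \<open>
  The approximant is the sum of the translates of \<open>k f\<close>, where \<open>k\<close> is the kernel divided by the
  sum of its translates. The error is \<open>\<Sum>n. k(s + i n \<tau>) (f(s) - f(s + i n \<tau>))\<close>; its
  differences are at most \<open>\<bar>n\<bar>\<close>, which the decay of the kernel absorbs.
\<close>

lemma periodic_approximation:
  assumes hol: "f holomorphic_on half_plane 0" and "\<tau> > 0"
    and strips: "bounded_on_strips f"
    and incr: "\<And>s. s \<in> half_plane 1 \<Longrightarrow> norm (f (s + \<i> * complex_of_real \<tau>) - f s) \<le> 1"
    and a: "0 < a" "a < 2 * pi / \<tau>"
  obtains p C where "p holomorphic_on half_plane 0" "\<And>s. p (s + \<i> * complex_of_real \<tau>) = p s"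
    "C \<ge> 0" "\<And>s. s \<in> half_plane 1 \<Longrightarrow> 0 \<le> Im s \<Longrightarrow> Im s \<le> \<tau> \<Longrightarrow> norm (f s - p s) \<le> C * exp (a * Re s)"
proof -
  define \<delta> where "\<delta> = a / 4"
  have \<delta>: "\<delta> > 0" "4 * \<delta> = a" using a by (simp_all add: \<delta>_def)
  obtain S where S: "S \<noteq> 0" "\<And>s. periodization \<tau> (jackson_kernel \<delta>) s = S"
    using jackson_kernel_mean_const[OF \<delta>(1) \<open>\<tau> > 0\<close>] a(2) \<delta>(2) by metis
  define P where "P = periodization \<tau> (\<lambda>s. jackson_kernel \<delta> s * f s)"
  have holP: "P holomorphic_on half_plane 0"
    unfolding P_def
  proof (rule periodization_holomorphic)
    show "(\<lambda>s. jackson_kernel \<delta> s * f s) holomorphic_on half_plane 0"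
      by (intro holomorphic_on_mult jackson_kernel_holomorphic hol)
    fix s assume s: "s \<in> half_plane 0"
    \<comment> \<open>the radius keeps the disc inside a strip that is bounded away from the imaginary axis\<close>
    define r where "r = Re s / 2"
    have r: "r > 0" using s by (simp add: r_def half_plane_def)
    obtain C where C: "C \<ge> 0" "\<And>w n. \<bar>Im w\<bar> \<le> \<bar>Im s\<bar> + r \<Longrightarrow>
        norm (jackson_kernel \<delta> (w + \<i> * complex_of_real (of_int n * \<tau>)))
          \<le> C * exp (4 * \<delta> * \<bar>Re w\<bar>) * (int_weight n)\<^sup>2"
      using jackson_kernel_decay[OF \<delta>(1) \<open>\<tau> > 0\<close>] by metis
    obtain M where M: "M \<ge> 0" "\<And>w. r \<le> Re w \<Longrightarrow> Re w \<le> 3 * r \<Longrightarrow> norm (f w) \<le> M"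
      using bounded_on_stripsE[OF strips r] by metis
    have cb: "\<bar>Im w\<bar> \<le> \<bar>Im s\<bar> + r" "r \<le> Re w" "Re w \<le> 3 * r" if "w \<in> cball s r" for w
    proof -
      have "norm (w - s) \<le> r" using that by (simp add: dist_norm norm_minus_commute)
      hence "\<bar>Re w - Re s\<bar> \<le> r" "\<bar>Im w - Im s\<bar> \<le> r"
        using abs_Re_le_cmod[of "w - s"] abs_Im_le_cmod[of "w - s"] by auto
      moreover have "Re s = 2 * r" by (simp add: r_def)
      ultimately show "\<bar>Im w\<bar> \<le> \<bar>Im s\<bar> + r" "r \<le> Re w" "Re w \<le> 3 * r" by linarith+
    qed
    have "norm (jackson_kernel \<delta> (w + \<i> * complex_of_real (of_int n * \<tau>)) * f (w + \<i> * complex_of_real (of_int n * \<tau>)))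
          \<le> (C * exp (4 * \<delta> * (3 * r)) * M) * int_weight n" if w: "w \<in> cball s r" for w n
    proof -
      have "norm (jackson_kernel \<delta> (w + \<i> * complex_of_real (of_int n * \<tau>)))
          \<le> C * exp (4 * \<delta> * \<bar>Re w\<bar>) * (int_weight n)\<^sup>2" by (intro C cb[OF w])
      also have "\<dots> \<le> C * exp (4 * \<delta> * (3 * r)) * int_weight n"
        using C(1) cb[OF w] \<delta>(1) r int_weight_pos[of n] int_weight_le_1[of n]
        by (intro mult_mono) (auto simp: power2_eq_square mult_left_le)
      finally have "norm (jackson_kernel \<delta> (w + \<i> * complex_of_real (of_int n * \<tau>)) * f (w + \<i> * complex_of_real (of_int n * \<tau>)))
          \<le> (C * exp (4 * \<delta> * (3 * r)) * int_weight n) * M"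
        unfolding norm_mult using C(1) int_weight_pos[of n]
        by (intro mult_mono M) (use cb[OF w] in auto)
      thus ?thesis by (simp only: mult_ac)
    qed
    moreover have "cball s r \<subseteq> half_plane 0"
      using cb r by (force simp: half_plane_def)
    ultimately show "\<exists>r>0. \<exists>C. cball s r \<subseteq> half_plane 0 \<and> (\<forall>w\<in>cball s r. \<forall>n.
        norm (jackson_kernel \<delta> (w + \<i> * complex_of_real (of_int n * \<tau>)) * f (w + \<i> * complex_of_real (of_int n * \<tau>)))
          \<le> C * int_weight n)"
      using r by blast
  qed simp
  obtain C where C: "C \<ge> 0" "\<And>w n. \<bar>Im w\<bar> \<le> \<tau> \<Longrightarrow>
      norm (jackson_kernel \<delta> (w + \<i> * complex_of_real (of_int n * \<tau>)))
        \<le> C * exp (4 * \<delta> * \<bar>Re w\<bar>) * (int_weight n)\<^sup>2"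
    using jackson_kernel_decay[OF \<delta>(1) \<open>\<tau> > 0\<close>] by metis
  define C' where "C' = C * infsum int_weight UNIV / norm S"
  show thesis
  proof (rule that[of "\<lambda>s. P s / S" C'])
    show "(\<lambda>s. P s / S) holomorphic_on half_plane 0"
      using S(1) by (intro holomorphic_on_divide holP) auto
    show "P (s + \<i> * complex_of_real \<tau>) / S = P s / S" for s
      unfolding P_def by (simp add: periodization_periodic)
    show "C' \<ge> 0"
      unfolding C'_def using C(1) infsum_nonneg[of UNIV int_weight] int_weight_pos
      by (simp add: less_imp_le)
    fix s assume s: "s \<in> half_plane 1" "0 \<le> Im s" "Im s \<le> \<tau>"
    let ?s = "\<lambda>n::int. s + \<i> * complex_of_real (of_int n * \<tau>)"
    let ?E = "C * exp (a * Re s)"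
    have k: "norm (jackson_kernel \<delta> (?s n)) \<le> ?E * (int_weight n)\<^sup>2" for n
      using C(2)[of s n] s \<delta>(2) by (simp add: half_plane_def)
    have "?E \<ge> 0" using C(1) by simp
    have "norm (jackson_kernel \<delta> (?s n) * f s) \<le> (?E * norm (f s)) * int_weight n" for n
    proof -
      have "(int_weight n)\<^sup>2 \<le> int_weight n"
        using int_weight_pos[of n] int_weight_le_1[of n] by (simp add: power2_eq_square mult_left_le)
      hence "norm (jackson_kernel \<delta> (?s n)) \<le> ?E * int_weight n"
        using k[of n] \<open>?E \<ge> 0\<close> by (meson mult_left_mono order_trans)
      hence "norm (jackson_kernel \<delta> (?s n)) * norm (f s) \<le> (?E * int_weight n) * norm (f s)"
        by (rule mult_right_mono) simp
      thus ?thesis by (simp only: norm_mult mult_ac)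
    qed
    hence sum1: "(\<lambda>n. jackson_kernel \<delta> (?s n) * f s) summable_on UNIV"
      by (rule int_weight_dominated(1))
    have diff: "norm (jackson_kernel \<delta> (?s n) * (f (?s n) - f s)) \<le> ?E * int_weight n" for n
    proof -
      have "\<bar>of_int n\<bar> * (int_weight n)\<^sup>2 \<le> int_weight n"
      proof -
        have "\<bar>of_int n :: real\<bar> \<le> 1 + (of_int n)\<^sup>2"
          using zero_le_power2[of "\<bar>of_int n :: real\<bar> - 1"] zero_le_power2[of "of_int n :: real"]
          by (simp add: power2_diff)
        hence "\<bar>of_int n\<bar> * int_weight n \<le> 1"
          by (simp add: int_weight_def divide_le_eq_1 add_pos_nonneg)
        thus ?thesis
          using mult_right_mono[of "\<bar>of_int n\<bar> * int_weight n" 1 "int_weight n"] int_weight_pos[of n]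
          by (simp add: power2_eq_square mult.assoc)
      qed
      from mult_left_mono[OF this \<open>?E \<ge> 0\<close>]
      have "?E * (int_weight n)\<^sup>2 * \<bar>of_int n\<bar> \<le> ?E * int_weight n"
        by (simp only: mult_ac)
      moreover have "norm (jackson_kernel \<delta> (?s n)) * norm (f (?s n) - f s) \<le> ?E * (int_weight n)\<^sup>2 * \<bar>of_int n\<bar>"
        using iterated_increment_bound[of 1 f \<tau> 1 s n, OF incr s(1)] \<open>?E \<ge> 0\<close> k
        by (intro mult_mono) auto
      ultimately show ?thesis by (simp add: norm_mult)
    qed
    have "P s = (\<Sum>\<^sub>\<infinity>n\<in>UNIV. jackson_kernel \<delta> (?s n) * f s + jackson_kernel \<delta> (?s n) * (f (?s n) - f s))"
      unfolding P_def periodization_def by (simp add: algebra_simps)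
    also have "\<dots> = (\<Sum>\<^sub>\<infinity>n\<in>UNIV. jackson_kernel \<delta> (?s n) * f s) + (\<Sum>\<^sub>\<infinity>n\<in>UNIV. jackson_kernel \<delta> (?s n) * (f (?s n) - f s))"
      by (rule infsum_add[OF sum1 int_weight_dominated(1)[OF diff]])
    also have "(\<Sum>\<^sub>\<infinity>n\<in>UNIV. jackson_kernel \<delta> (?s n) * f s) = S * f s"
      unfolding infsum_cmult_left' using S(2)[of s] by (simp add: periodization_def)
    finally have "f s - P s / S = - (\<Sum>\<^sub>\<infinity>n\<in>UNIV. jackson_kernel \<delta> (?s n) * (f (?s n) - f s)) / S"
      using S(1) by (simp add: field_simps)
    hence "norm (f s - P s / S) = norm (\<Sum>\<^sub>\<infinity>n\<in>UNIV. jackson_kernel \<delta> (?s n) * (f (?s n) - f s)) / norm S"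
      by (simp add: norm_divide)
    also have "\<dots> \<le> (?E * infsum int_weight UNIV) / norm S"
      by (intro divide_right_mono int_weight_dominated(2) diff) simp
    finally show "norm (f s - P s / S) \<le> C' * exp (a * Re s)"
      by (simp add: C'_def mult_ac)
  qed
qed

lemma periodic_bounded_on_strips:
  assumes hol: "p holomorphic_on half_plane 0" and "\<tau> > 0"
    and per: "\<And>s. s \<in> half_plane 0 \<Longrightarrow> p (s + \<i> * complex_of_real \<tau>) = p s"
  shows "bounded_on_strips p"
  unfolding bounded_on_strips_def
proof (intro allI impI)
  fix \<kappa> K :: real assume "\<kappa> > 0"
  let ?R = "cbox (Complex \<kappa> 0) (Complex K \<tau>)"
  have "?R \<subseteq> half_plane 0" using \<open>\<kappa> > 0\<close> by (auto simp: in_cbox_complex_iff half_plane_def)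
  hence "bounded (p ` ?R)"
    using hol by (intro compact_imp_bounded compact_continuous_image compact_cbox
        holomorphic_on_imp_continuous_on holomorphic_on_subset[OF hol])
  then obtain M where M: "\<And>s. s \<in> ?R \<Longrightarrow> norm (p s) \<le> M"
    unfolding bounded_iff by blast
  have "norm (p s) \<le> M" if "\<kappa> \<le> Re s" "Re s \<le> K" for s
  proof -
    obtain n where n: "0 \<le> Im (s + \<i> * complex_of_real (of_int n * \<tau>))"
        "Im (s + \<i> * complex_of_real (of_int n * \<tau>)) \<le> \<tau>"
      using exists_shift_to_period[OF \<open>\<tau> > 0\<close>] by metis
    have "p (s + \<i> * complex_of_real (of_int n * \<tau>)) = p s"
      using that \<open>\<kappa> > 0\<close> by (intro periodic_int_multiple[of 0] per) (auto simp: half_plane_def)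
    thus ?thesis
      using M[of "s + \<i> * complex_of_real (of_int n * \<tau>)"] n that by (simp add: in_cbox_complex_iff)
  qed
  thus "\<exists>M. \<forall>s. \<kappa> \<le> Re s \<and> Re s \<le> K \<longrightarrow> norm (p s) \<le> M" by blast
qed

section \<open>Splitting off the periodic part\<close>

lemma almost_periodic_bounded_on_strips:
  assumes "\<And>\<kappa>. \<kappa> > 0 \<Longrightarrow> almost_periodic_in \<kappa> f"
  shows "bounded_on_strips f"
  unfolding bounded_on_strips_def
proof (intro allI impI)
  fix \<kappa> K :: real assume "\<kappa> > 0"
  hence ap: "almost_periodic_in (\<kappa> / 2) f" using assms by simp
  then obtain L where L: "\<And>a. translation_numbers (\<kappa> / 2) f 1 \<inter> {a<..<a + L} \<noteq> {}"
    unfolding almost_periodic_in_def relatively_dense_def by (meson zero_less_one)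
  let ?R = "cbox (Complex \<kappa> 0) (Complex K L)"
  have "?R \<subseteq> half_plane (\<kappa> / 2)"
    using \<open>\<kappa> > 0\<close> by (auto simp: in_cbox_complex_iff half_plane_def)
  hence "bounded (f ` ?R)"
    using ap unfolding almost_periodic_in_def
    by (intro compact_imp_bounded compact_continuous_image compact_cbox) (blast intro: continuous_on_subset)
  then obtain M where M: "\<And>s. s \<in> ?R \<Longrightarrow> norm (f s) \<le> M"
    unfolding bounded_iff by blast
  have "norm (f s) \<le> M + 1" if "\<kappa> \<le> Re s" "Re s \<le> K" for s
  proof -
    obtain \<tau> where \<tau>: "\<tau> \<in> translation_numbers (\<kappa> / 2) f 1" "- Im s < \<tau>" "\<tau> < - Im s + L"
      using L[of "- Im s"] by auto
    have "s \<in> half_plane (\<kappa> / 2)" using that \<open>\<kappa> > 0\<close> by (simp add: half_plane_def)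
    hence "norm (f (s + \<i> * complex_of_real \<tau>) - f s) \<le> 1"
      using \<tau>(1) by (simp add: translation_numbers_def vtranslate_def)
    moreover have "norm (f (s + \<i> * complex_of_real \<tau>)) \<le> M"
      using \<tau> that by (intro M) (simp add: in_cbox_complex_iff)
    ultimately show ?thesis
      using norm_triangle_ineq2[of "f s" "f (s + \<i> * complex_of_real \<tau>)"] by (simp add: norm_minus_commute)
  qed
  thus "\<exists>M. \<forall>s. \<kappa> \<le> Re s \<and> Re s \<le> K \<longrightarrow> norm (f s) \<le> M" by blast
qed

text \<open>
  The approximant \<open>p\<close> is built for one growth rate \<open>a\<close> below the critical rate \<open>2 \<pi> / \<tau>\<close>. The error \<open>f - p\<close>
  nevertheless grows more slowly than every exponential: an approximant \<open>q\<close> with rate \<open>\<epsilon>\<close> differs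
  from \<open>p\<close> by a periodic function of subcritical growth, hence by a bounded function. The
  factor \<open>1 + \<bar>s\<bar>\<close> accounts for the number of steps \<open>\<tau>\<close> that are needed to reach the
  strip \<open>0 \<le> Im s \<le> \<tau>\<close>. Phragmen--Lindelof then applies, since \<open>f\<close> and \<open>p\<close> are bounded on
  vertical lines.
\<close>

lemma periodic_part_exists:
  assumes hol: "f holomorphic_on half_plane 0" and "\<tau> > 0"
    and strips: "bounded_on_strips f"
    and incr: "\<And>s. s \<in> half_plane 1 \<Longrightarrow> norm (f (s + \<i> * complex_of_real \<tau>) - f s) \<le> 1"
  obtains p where "p holomorphic_on half_plane 0" "\<And>s. p (s + \<i> * complex_of_real \<tau>) = p s"
    "\<And>\<kappa>. \<kappa> > 0 \<Longrightarrow> bounded_in \<kappa> (\<lambda>s. f s - p s)"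
proof -
  \<comment> \<open>half of the critical rate\<close>
  define a where "a = pi / \<tau>"
  have a: "0 < a" "a < 2 * pi / \<tau>" using \<open>\<tau> > 0\<close> by (simp_all add: a_def divide_strict_right_mono)
  obtain p C where p: "p holomorphic_on half_plane 0" "\<And>s. p (s + \<i> * complex_of_real \<tau>) = p s"
    and C: "C \<ge> 0" "\<And>s. s \<in> half_plane 1 \<Longrightarrow> 0 \<le> Im s \<Longrightarrow> Im s \<le> \<tau> \<Longrightarrow> norm (f s - p s) \<le> C * exp (a * Re s)"
    using periodic_approximation[OF hol \<open>\<tau> > 0\<close> strips incr a] by metis
  have p_strips: "bounded_on_strips p"
    by (rule periodic_bounded_on_strips[OF p(1) \<open>\<tau> > 0\<close> p(2)])
  have growth: "\<exists>C. \<forall>s. Re s \<ge> 2 \<longrightarrow> norm (f s - p s) \<le> C * exp (\<epsilon> * Re s) * (1 + norm s)"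
    if "\<epsilon> > 0" for \<epsilon>
  proof -
    define e where "e = min \<epsilon> a"
    have e: "0 < e" "e < 2 * pi / \<tau>" "e \<le> a" "e \<le> \<epsilon>" using that a by (auto simp: e_def)
    obtain q C' where q: "q holomorphic_on half_plane 0" "\<And>s. q (s + \<i> * complex_of_real \<tau>) = q s"
      and C': "C' \<ge> 0" "\<And>s. s \<in> half_plane 1 \<Longrightarrow> 0 \<le> Im s \<Longrightarrow> Im s \<le> \<tau> \<Longrightarrow> norm (f s - q s) \<le> C' * exp (e * Re s)"
      using periodic_approximation[OF hol \<open>\<tau> > 0\<close> strips incr e(1,2)] by metis
    have per_int: "q (s + \<i> * complex_of_real (of_int n * \<tau>)) = q s"
      "p (s + \<i> * complex_of_real (of_int n * \<tau>)) = p s" for s n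
      by (rule periodic_int_multiple[of "Re s - 1"]; simp add: p q half_plane_def)+
    have "\<exists>B. \<forall>s\<in>half_plane 1. norm (q s - p s) \<le> B"
    proof (rule periodic_slow_growth_bounded[OF _ \<open>\<tau> > 0\<close> _ _ a(2)])
      show "(\<lambda>s. q s - p s) holomorphic_on half_plane 0"
        by (intro holomorphic_on_diff p q)
      show "q (s + \<i> * complex_of_real \<tau>) - p (s + \<i> * complex_of_real \<tau>) = q s - p s" for s
        by (simp add: p q)
      fix s assume s: "s \<in> half_plane 1"
      obtain n where n: "0 \<le> Im (s + \<i> * complex_of_real (of_int n * \<tau>))"
          "Im (s + \<i> * complex_of_real (of_int n * \<tau>)) \<le> \<tau>"
        using exists_shift_to_period[OF \<open>\<tau> > 0\<close>] by metis
      define w where "w = s + \<i> * complex_of_real (of_int n * \<tau>)"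
      have w: "w \<in> half_plane 1" "Re w = Re s"
        using s by (simp_all add: w_def half_plane_def)
      have "q s - p s = (f w - p w) - (f w - q w)" by (simp only: w_def per_int) simp
      hence "norm (q s - p s) \<le> norm (f w - p w) + norm (f w - q w)"
        using norm_triangle_ineq4 by metis
      also have "\<dots> \<le> C * exp (a * Re s) + C' * exp (e * Re s)"
        using C(2)[of w] C'(2)[of w] w n unfolding w_def[symmetric] by (intro add_mono) auto
      also have "\<dots> \<le> C * exp (a * Re s) + C' * exp (a * Re s)"
        using C' e s by (intro add_mono order_refl mult_left_mono) (auto simp: half_plane_def)
      finally show "norm (q s - p s) \<le> (C + C') * exp (a * Re s)" by (simp add: distrib_right)
    qed
    then obtain B where B: "\<And>s. s \<in> half_plane 1 \<Longrightarrow> norm (q s - p s) \<le> B" by blast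
    have "norm (f s - p s) \<le> (C' + \<bar>B\<bar> + 1 + 1 / \<tau>) * exp (\<epsilon> * Re s) * (1 + norm s)"
      if s: "Re s \<ge> 2" for s
    proof -
      obtain n where n: "0 \<le> Im (s + \<i> * complex_of_real (of_int n * \<tau>))"
          "Im (s + \<i> * complex_of_real (of_int n * \<tau>)) \<le> \<tau>"
          "\<bar>of_int n\<bar> \<le> 1 + \<bar>Im s\<bar> / \<tau>"
        using exists_shift_to_period[OF \<open>\<tau> > 0\<close>] by metis
      define w where "w = s + \<i> * complex_of_real (of_int n * \<tau>)"
      have w: "w \<in> half_plane 1" "Re w = Re s" "s \<in> half_plane 1"
        using s by (simp_all add: w_def half_plane_def)
      have 1: "norm (f w - f s) \<le> \<bar>of_int n\<bar>"
        using iterated_increment_bound[of 1 f \<tau> 1 s n, OF incr w(3)] by (simp only: w_def mult_1_right)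
      have 2: "norm (f w - q w) \<le> C' * exp (e * Re s)"
        using C'(2)[of w] w n unfolding w_def[symmetric] by simp
      have 3: "norm (q w - p w) \<le> \<bar>B\<bar>" using B[OF w(1)] by simp
      have "f s - p s = (f w - q w) + (q w - p w) - (f w - f s)"
        using per_int(2)[of s n] by (simp add: w_def)
      hence "norm (f s - p s) \<le> norm (f w - q w) + norm (q w - p w) + norm (f w - f s)"
        using norm_triangle_ineq4[of "(f w - q w) + (q w - p w)" "f w - f s"]
          norm_triangle_ineq[of "f w - q w" "q w - p w"] by simp
      also have "\<dots> \<le> C' * exp (e * Re s) + \<bar>B\<bar> + (1 + \<bar>Im s\<bar> / \<tau>)"
        using 1 2 3 n(3) by linarith
      also have "\<dots> \<le> (C' + \<bar>B\<bar> + 1 + 1 / \<tau>) * (exp (\<epsilon> * Re s) * (1 + norm s))"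
      proof -
        define X where "X = exp (\<epsilon> * Re s) * (1 + norm s)"
        have E: "1 \<le> exp (\<epsilon> * Re s)" using \<open>\<epsilon> > 0\<close> s by simp
        have X1: "1 + norm s \<le> X"
          unfolding X_def using mult_right_mono[OF E, of "1 + norm s"] by simp
        have "exp (e * Re s) \<le> exp (\<epsilon> * Re s)" using e s by simp
        also have "\<dots> \<le> X" unfolding X_def using mult_left_mono[of 1 "1 + norm s" "exp (\<epsilon> * Re s)"] by simp
        finally have "C' * exp (e * Re s) \<le> C' * X" using C'(1) by (rule mult_left_mono)
        moreover have "1 \<le> X" using X1 norm_ge_zero[of s] by linarith
        moreover from this have "\<bar>B\<bar> \<le> \<bar>B\<bar> * X"
          using mult_left_mono[of 1 X "\<bar>B\<bar>"] by simp
        moreover have "\<bar>Im s\<bar> / \<tau> \<le> 1 / \<tau> * X"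
          using X1 abs_Im_le_cmod[of s] \<open>\<tau> > 0\<close> by (simp add: divide_right_mono)
        ultimately show ?thesis unfolding X_def[symmetric] by (simp add: distrib_right)
      qed
      finally show ?thesis by (simp add: mult.assoc)
    qed
    thus ?thesis by blast
  qed
  obtain M1 where M1: "M1 \<ge> 0" "\<And>s. Re s = 2 \<Longrightarrow> norm (f s) \<le> M1"
    using bounded_on_stripsE[OF strips zero_less_numeral, of _ 2] by (metis order_refl)
  obtain M2 where M2: "M2 \<ge> 0" "\<And>s. Re s = 2 \<Longrightarrow> norm (p s) \<le> M2"
    using bounded_on_stripsE[OF p_strips zero_less_numeral, of _ 2] by (metis order_refl)
  have far: "norm (f s - p s) \<le> M1 + M2" if "Re s \<ge> 2" for s
  proof (rule phragmen_lindelof_half_plane[of "\<lambda>s. f s - p s" 0 2, OF _ _ _ growth that])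
    show "(\<lambda>s. f s - p s) holomorphic_on half_plane 0"
      by (intro holomorphic_on_diff hol p)
    show "norm (f s - p s) \<le> M1 + M2" if "Re s = 2" for s
      using M1(2)[OF that] M2(2)[OF that] norm_triangle_ineq4[of "f s" "p s"] by linarith
  qed auto
  have "bounded_in \<kappa> (\<lambda>s. f s - p s)" if \<kappa>: "\<kappa> > 0" for \<kappa>
  proof -
    obtain N1 where N1: "N1 \<ge> 0" "\<And>s. \<kappa> \<le> Re s \<Longrightarrow> Re s \<le> 2 \<Longrightarrow> norm (f s) \<le> N1"
      using bounded_on_stripsE[OF strips \<kappa>] by metis
    obtain N2 where N2: "N2 \<ge> 0" "\<And>s. \<kappa> \<le> Re s \<Longrightarrow> Re s \<le> 2 \<Longrightarrow> norm (p s) \<le> N2"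
      using bounded_on_stripsE[OF p_strips \<kappa>] by metis
    have "norm (f s - p s) \<le> max (M1 + M2) (N1 + N2)" if "s \<in> half_plane \<kappa>" for s
    proof (cases "Re s \<ge> 2")
      case True thus ?thesis using far[of s] by simp
    next
      case False
      hence "norm (f s) \<le> N1" "norm (p s) \<le> N2"
        using that by (auto intro!: N1 N2 simp: half_plane_def)
      thus ?thesis using norm_triangle_ineq4[of "f s" "p s"] by linarith
    qed
    thus ?thesis unfolding bounded_in_def bounded_iff by blast
  qed
  thus thesis using that p by blast
qed

section \<open>Translation numbers that are multiples of a period\<close>

text \<open>
  Sort the numbers in \<open>E (\<epsilon> / 3)\<close> by their residue modulo \<open>\<tau>\<close> into finitely many classes of
  width \<open>\<tau> / N\<close> and choose one representative of each class. A number \<open>x\<close> and the representative \<open>r\<close> of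
  its class differ by a multiple \<open>y\<close> of \<open>\<tau>\<close> up to a small error, and the error itself belongs to
  \<open>E (\<epsilon> / 3)\<close>; hence \<open>y \<in> E \<epsilon>\<close>. As there are only finitely many representatives, \<open>y\<close> stays within a
  fixed distance of \<open>x\<close>.
\<close>

lemma multiples_relatively_dense:
  fixes E :: "real \<Rightarrow> real set"
  assumes dense: "\<And>\<epsilon>. \<epsilon> > 0 \<Longrightarrow> relatively_dense (E \<epsilon>)"
    and diff: "\<And>x y \<epsilon> \<epsilon>'. x \<in> E \<epsilon> \<Longrightarrow> y \<in> E \<epsilon>' \<Longrightarrow> x - y \<in> E (\<epsilon> + \<epsilon>')"
    and small: "\<And>\<epsilon>. \<epsilon> > 0 \<Longrightarrow> \<exists>d>0. \<forall>x. \<bar>x\<bar> < d \<longrightarrow> x \<in> E \<epsilon>"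
    and "\<tau> > 0" "\<epsilon> > 0"
  shows "relatively_dense {x \<in> E \<epsilon>. \<exists>m::int. x = of_int m * \<tau>}"
proof -
  define e where "e = \<epsilon> / 3"
  have "e > 0" using \<open>\<epsilon> > 0\<close> by (simp add: e_def)
  obtain d where d: "d > 0" "\<And>x. \<bar>x\<bar> < d \<Longrightarrow> x \<in> E e" using small[OF \<open>e > 0\<close>] by blast
  obtain L where L: "L > 0" "\<And>a. E e \<inter> {a<..<a + L} \<noteq> {}"
    using dense[OF \<open>e > 0\<close>] unfolding relatively_dense_def by blast
  obtain N :: nat where N: "\<tau> / d < real N" using reals_Archimedean2 by blast
  have "N > 0" using N \<open>\<tau> > 0\<close> d(1) by (metis divide_pos_pos less_asym' neq0_conv of_nat_0)
  have Nd: "\<tau> / N < d" using N \<open>\<tau> > 0\<close> d(1) \<open>N > 0\<close> by (simp add: field_simps)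
  \<comment> \<open>the class of \<open>x\<close>: which of \<open>N\<close> equal parts of the circle of length \<open>\<tau>\<close> contains it\<close>
  define k where "k = (\<lambda>x. \<lfloor>real N * x / \<tau>\<rfloor> mod int N)"
  have "finite (k ` E e)"
    by (rule finite_subset[of _ "{0..<int N}"]) (use \<open>N > 0\<close> in \<open>auto simp: k_def\<close>)
  then obtain R where R: "R \<subseteq> E e" "finite R" "k ` E e = k ` R"
    using finite_subset_image[of "k ` E e" k "E e"] by auto
  obtain b where b: "\<And>r. r \<in> R \<Longrightarrow> \<bar>r\<bar> \<le> b" "b \<ge> 0"
  proof (rule that[of "\<Sum>r\<in>R. \<bar>r\<bar>"])
    show "\<bar>r\<bar> \<le> (\<Sum>r\<in>R. \<bar>r\<bar>)" if "r \<in> R" for r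
      using member_le_sum[OF that, of abs] R(2) by simp
  qed (simp add: sum_nonneg)
  define l where "l = L + 2 * (b + d)"
  show ?thesis unfolding relatively_dense_def
  proof (intro exI[of _ l] conjI allI)
    show "l > 0" using L(1) b(2) d(1) by (simp add: l_def)
    fix a
    obtain x where x: "x \<in> E e" "a + b + d < x" "x < a + b + d + L"
      using L(2)[of "a + b + d"] by auto
    obtain r where r: "r \<in> R" "k x = k r"
      using R(3) x(1) by blast
    obtain m :: int where m: "\<lfloor>real N * x / \<tau>\<rfloor> - \<lfloor>real N * r / \<tau>\<rfloor> = int N * m"
      using r(2) unfolding k_def by (metis dvdE mod_eq_dvd_iff)
    define y where "y = of_int m * \<tau>"
    have "\<bar>real N * x / \<tau> - real N * r / \<tau> - of_int (int N * m)\<bar> < 1"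
      unfolding m[symmetric] by linarith
    moreover have "real N * x / \<tau> - real N * r / \<tau> - of_int (int N * m) = real N / \<tau> * (x - r - y)"
      using \<open>\<tau> > 0\<close> by (simp add: y_def field_simps)
    ultimately have "real N / \<tau> * \<bar>x - r - y\<bar> < 1"
      using \<open>\<tau> > 0\<close> by (simp add: abs_mult)
    hence "\<bar>x - r - y\<bar> < \<tau> / N"
      using \<open>\<tau> > 0\<close> \<open>N > 0\<close> by (simp add: field_simps)
    hence xy: "\<bar>x - r - y\<bar> < d" using Nd by linarith
    have "(x - r) - (x - r - y) \<in> E (e + e + e)"
      using x(1) r(1) R(1) d(2)[OF xy] by (intro diff) auto
    hence "y \<in> E \<epsilon>" by (simp add: e_def)
    moreover have "\<bar>x - y\<bar> < b + d" using xy b(1)[OF r(1)] by linarith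
    hence "y \<in> {a<..<a + l}" using x by (auto simp: l_def)
    ultimately show "{x \<in> E \<epsilon>. \<exists>m::int. x = of_int m * \<tau>} \<inter> {a<..<a + l} \<noteq> {}"
      unfolding y_def by blast
  qed
qed

lemma relatively_dense_mono: "relatively_dense A \<Longrightarrow> A \<subseteq> B \<Longrightarrow> relatively_dense B"
  unfolding relatively_dense_def by blast

text \<open>
  Cauchy's inequality on discs of radius \<open>r\<close> bounds the derivative along the vertical line through \<open>s\<close>.
\<close>

lemma vertical_increment_bound:
  assumes hol: "F holomorphic_on half_plane 0" and r: "r > 0" "r < Re s"
    and bound: "\<And>z. \<bar>Re z - Re s\<bar> \<le> r \<Longrightarrow> norm (F z) \<le> M"
  shows "norm (F (s + \<i> * complex_of_real x) - F s) \<le> M / r * \<bar>x\<bar>"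
proof -
  let ?l = "{z. Re z = Re s}"
  have "norm (F (s + \<i> * complex_of_real x) - F s) \<le> M / r * norm (s + \<i> * complex_of_real x - s)"
  proof (rule field_differentiable_bound[where f' = "deriv F" and S = ?l])
    show "convex ?l"
    proof -
      have "?l = {z. Re z \<le> Re s} \<inter> {z. Re z \<ge> Re s}" by auto
      thus ?thesis by (simp only: convex_Int convex_halfspace_Re_le convex_halfspace_Re_ge)
    qed
    fix z assume z: "z \<in> ?l"
    hence "z \<in> half_plane 0" using r by (simp add: half_plane_def)
    thus "(F has_field_derivative deriv F z) (at z within ?l)"
      using hol holomorphic_derivI[OF hol open_half_plane] has_field_derivative_at_within by blast
    have "cball z r \<subseteq> half_plane 0"
    proof
      fix w assume "w \<in> cball z r"
      hence "\<bar>Re (w - z)\<bar> \<le> r"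
        using abs_Re_le_cmod[of "w - z"] by (simp add: dist_norm norm_minus_commute)
      thus "w \<in> half_plane 0" using r z by (simp add: half_plane_def)
    qed
    hence holz: "F holomorphic_on cball z r" by (rule holomorphic_on_subset[OF hol])
    have "norm ((deriv ^^ 1) F z) \<le> fact 1 * M / r ^ 1"
    proof (rule Cauchy_inequality[OF _ _ r(1)])
      show "F holomorphic_on ball z r" using holz ball_subset_cball holomorphic_on_subset by blast
      show "continuous_on (cball z r) F" using holz by (rule holomorphic_on_imp_continuous_on)
      show "norm (F w) \<le> M" if "norm (z - w) = r" for w
        using abs_Re_le_cmod[of "z - w"] that z by (intro bound) (simp add: abs_minus_commute)
    qed
    thus "norm (deriv F z) \<le> M / r" by simp
  qed auto
  thus ?thesis by (simp add: norm_mult)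
qed

text \<open>
  The real parts range over an arbitrary set \<open>I\<close>, so that half-planes and single vertical lines
  are treated alike.
\<close>

definition translation_numbers_on :: "real set \<Rightarrow> (complex \<Rightarrow> complex) \<Rightarrow> real \<Rightarrow> real set" where
  "translation_numbers_on I F \<epsilon> =
     {x. \<forall>s. Re s \<in> I \<longrightarrow> norm (F (s + \<i> * complex_of_real x) - F s) \<le> \<epsilon>}"

lemma period_multiples_relatively_dense:
  assumes hol: "F holomorphic_on half_plane 0" and r: "r > 0" "\<And>\<sigma>. \<sigma> \<in> I \<Longrightarrow> r < \<sigma>"
    and bound: "\<And>\<sigma> z. \<sigma> \<in> I \<Longrightarrow> \<bar>Re z - \<sigma>\<bar> \<le> r \<Longrightarrow> norm (F z) \<le> M"
    and dense: "\<And>\<epsilon>. \<epsilon> > 0 \<Longrightarrow> relatively_dense (translation_numbers_on I F \<epsilon>)"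
    and "\<tau> > 0" "\<epsilon> > 0"
  shows "relatively_dense {x \<in> translation_numbers_on I F \<epsilon>. \<exists>m::int. x = of_int m * \<tau>}"
proof (rule multiples_relatively_dense[OF dense _ _ \<open>\<tau> > 0\<close> \<open>\<epsilon> > 0\<close>])
  fix x y \<epsilon> \<epsilon>' :: real
  assume x: "x \<in> translation_numbers_on I F \<epsilon>" and y: "y \<in> translation_numbers_on I F \<epsilon>'"
  show "x - y \<in> translation_numbers_on I F (\<epsilon> + \<epsilon>')"
    unfolding translation_numbers_on_def
  proof (intro CollectI allI impI)
    fix s assume s: "Re s \<in> I"
    define w where "w = s + \<i> * complex_of_real (x - y)"
    have w: "Re w \<in> I" "w + \<i> * complex_of_real y = s + \<i> * complex_of_real x"
      using s by (simp_all add: w_def algebra_simps)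
    have "norm (F (s + \<i> * complex_of_real x) - F s) \<le> \<epsilon>"
      using x s unfolding translation_numbers_on_def by blast
    moreover have "norm (F (s + \<i> * complex_of_real x) - F w) \<le> \<epsilon>'"
      using y w unfolding translation_numbers_on_def by (metis (mono_tags, lifting) mem_Collect_eq)
    ultimately show "norm (F (s + \<i> * complex_of_real (x - y)) - F s) \<le> \<epsilon> + \<epsilon>'"
      unfolding w_def[symmetric]
      using norm_triangle_ineq4[of "F (s + \<i> * complex_of_real x) - F s" "F (s + \<i> * complex_of_real x) - F w"]
      by simp
  qed
next
  fix \<epsilon> :: real assume "\<epsilon> > 0"
  define d where "d = \<epsilon> * r / (\<bar>M\<bar> + 1)"
  have "d > 0" using \<open>\<epsilon> > 0\<close> r by (simp add: d_def)
  moreover have "x \<in> translation_numbers_on I F \<epsilon>" if "\<bar>x\<bar> < d" for x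
    unfolding translation_numbers_on_def
  proof (intro CollectI allI impI)
    fix s assume s: "Re s \<in> I"
    have "norm (F (s + \<i> * complex_of_real x) - F s) \<le> M / r * \<bar>x\<bar>"
      using r s bound by (intro vertical_increment_bound[OF hol]) auto
    also have "\<dots> \<le> (\<bar>M\<bar> + 1) / r * \<bar>x\<bar>"
      using r by (intro mult_right_mono divide_right_mono) auto
    also have "\<dots> \<le> (\<bar>M\<bar> + 1) / r * d"
      using r that by (intro mult_left_mono) auto
    also have "\<dots> = \<epsilon>"
    proof -
      have "\<bar>M\<bar> + 1 \<noteq> 0" by linarith
      thus ?thesis using r by (simp add: d_def)
    qed
    finally show "norm (F (s + \<i> * complex_of_real x) - F s) \<le> \<epsilon>" .
  qed
  ultimately show "\<exists>d>0. \<forall>x. \<bar>x\<bar> < d \<longrightarrow> x \<in> translation_numbers_on I F \<epsilon>" by blast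
qed

text \<open>
  The bound in the larger half-plane leaves room for Cauchy discs of radius \<open>\<kappa> / 2\<close> around the
  points of \<open>\<complex>\<^sub>\<kappa>\<close>, which make \<open>b\<close> uniformly continuous there.
\<close>

lemma almost_periodic_add_periodic:
  assumes hol: "b holomorphic_on half_plane 0" and "\<kappa> > 0"
    and bounded: "bounded_in (\<kappa> / 2) b" and ap: "almost_periodic_in \<kappa> b"
    and cont: "continuous_on (half_plane \<kappa>) f" and per: "periodic_in \<kappa> p"
    and f: "\<And>s. s \<in> half_plane \<kappa> \<Longrightarrow> f s = p s + b s"
  shows "almost_periodic_in \<kappa> f"
  unfolding almost_periodic_in_def
proof (intro conjI cont allI impI)
  fix \<epsilon> :: real assume "\<epsilon> > 0"
  obtain \<tau> where \<tau>: "\<tau> > 0" "\<And>s. s \<in> half_plane \<kappa> \<Longrightarrow> p (s + \<i> * complex_of_real \<tau>) = p s"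
    using per unfolding periodic_in_def vtranslate_def by blast
  obtain M where M: "\<And>s. s \<in> half_plane (\<kappa> / 2) \<Longrightarrow> norm (b s) \<le> M"
    using bounded unfolding bounded_in_def bounded_iff by blast
  have eq: "translation_numbers_on {\<kappa><..} b \<epsilon> = translation_numbers \<kappa> b \<epsilon>" for \<epsilon>
    by (simp add: translation_numbers_on_def translation_numbers_def vtranslate_def half_plane_def)
  have "relatively_dense {x \<in> translation_numbers_on {\<kappa><..} b \<epsilon>. \<exists>m::int. x = of_int m * \<tau>}"
  proof (rule period_multiples_relatively_dense[where r = "\<kappa> / 2" and M = M, OF hol])
    show "norm (b z) \<le> M" if "\<sigma> \<in> {\<kappa><..}" "\<bar>Re z - \<sigma>\<bar> \<le> \<kappa> / 2" for \<sigma> z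
    proof -
      have "\<kappa> / 2 < Re z" using that unfolding greaterThan_iff by linarith
      thus ?thesis by (intro M) (simp add: half_plane_def)
    qed
    show "relatively_dense (translation_numbers_on {\<kappa><..} b \<epsilon>)" if "\<epsilon> > 0" for \<epsilon>
      using ap that unfolding eq almost_periodic_in_def by blast
  qed (use \<open>\<kappa> > 0\<close> \<tau> \<open>\<epsilon> > 0\<close> in auto)
  moreover have "{x \<in> translation_numbers_on {\<kappa><..} b \<epsilon>. \<exists>m::int. x = of_int m * \<tau>}
      \<subseteq> translation_numbers \<kappa> f \<epsilon>"
  proof (intro subsetI)
    fix x assume "x \<in> {x \<in> translation_numbers_on {\<kappa><..} b \<epsilon>. \<exists>m::int. x = of_int m * \<tau>}"
    then obtain m :: int where x: "x \<in> translation_numbers \<kappa> b \<epsilon>" "x = of_int m * \<tau>"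
      unfolding eq by blast
    have "norm (f (s + \<i> * complex_of_real x) - f s) \<le> \<epsilon>" if s: "s \<in> half_plane \<kappa>" for s
    proof -
      have "p (s + \<i> * complex_of_real x) = p s"
        unfolding x(2) by (rule periodic_int_multiple[of \<kappa> p \<tau>, OF \<tau>(2) s])
      thus ?thesis
        using x(1) s by (simp add: f translation_numbers_def vtranslate_def)
    qed
    thus "x \<in> translation_numbers \<kappa> f \<epsilon>"
      by (simp add: translation_numbers_def vtranslate_def)
  qed
  ultimately show "relatively_dense (translation_numbers \<kappa> f \<epsilon>)"
    by (rule relatively_dense_mono)
qed

text \<open>
  In the half-plane \<open>p\<close> is not uniformly continuous in general, so common translation numbers of
  \<open>f\<close> and \<open>p\<close> are sought only on the line \<open>Re s = \<kappa>\<close>. There they are translation numbers of the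
  bounded function \<open>f - p\<close>, and Phragmen--Lindelof carries the estimate to the half-plane.
\<close>

lemma almost_periodic_minus_periodic:
  assumes f: "f holomorphic_on half_plane 0" "\<And>\<kappa>. \<kappa> > 0 \<Longrightarrow> almost_periodic_in \<kappa> f"
    and p: "p holomorphic_on half_plane 0" "\<And>s. p (s + \<i> * complex_of_real \<tau>) = p s" "\<tau> > 0"
    and bounded: "bounded_in (\<kappa> / 2) (\<lambda>s. f s - p s)" and "\<kappa> > 0"
  shows "almost_periodic_in \<kappa> (\<lambda>s. f s - p s)"
proof -
  define b where "b = (\<lambda>s. f s - p s)"
  have holb: "b holomorphic_on half_plane 0"
    unfolding b_def by (intro holomorphic_on_diff f p)
  obtain B where B: "\<And>s. s \<in> half_plane (\<kappa> / 2) \<Longrightarrow> norm (b s) \<le> B"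
    using bounded unfolding bounded_in_def bounded_iff b_def by blast
  obtain M where M: "\<And>s. \<kappa> / 2 \<le> Re s \<Longrightarrow> Re s \<le> 3 * \<kappa> / 2 \<Longrightarrow> norm (f s) \<le> M"
    using bounded_on_stripsE[OF almost_periodic_bounded_on_strips[OF f(2)], of "\<kappa> / 2" "3 * \<kappa> / 2"]
      \<open>\<kappa> > 0\<close> by (metis half_gt_zero)
  have "relatively_dense (translation_numbers \<kappa> b \<epsilon>)" if "\<epsilon> > 0" for \<epsilon>
  proof -
    have "relatively_dense {x \<in> translation_numbers_on {\<kappa>} f \<epsilon>. \<exists>m::int. x = of_int m * \<tau>}"
    proof (rule period_multiples_relatively_dense[where r = "\<kappa> / 2" and M = M, OF f(1)])
      show "norm (f z) \<le> M" if "\<sigma> \<in> {\<kappa>}" "\<bar>Re z - \<sigma>\<bar> \<le> \<kappa> / 2" for \<sigma> z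
      proof -
        have "\<kappa> / 2 \<le> Re z" "Re z \<le> 3 * \<kappa> / 2" using that unfolding singleton_iff by linarith+
        thus ?thesis by (rule M)
      qed
      show "relatively_dense (translation_numbers_on {\<kappa>} f \<epsilon>)" if "\<epsilon> > 0" for \<epsilon>
      proof (rule relatively_dense_mono)
        show "relatively_dense (translation_numbers (\<kappa> / 2) f \<epsilon>)"
          using f(2)[of "\<kappa> / 2"] \<open>\<kappa> > 0\<close> that unfolding almost_periodic_in_def by simp
        show "translation_numbers (\<kappa> / 2) f \<epsilon> \<subseteq> translation_numbers_on {\<kappa>} f \<epsilon>"
          using \<open>\<kappa> > 0\<close>
          by (auto simp: translation_numbers_def translation_numbers_on_def vtranslate_def half_plane_def)
      qed
    qed (use \<open>\<kappa> > 0\<close> p(3) that in auto)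
    moreover have "{x \<in> translation_numbers_on {\<kappa>} f \<epsilon>. \<exists>m::int. x = of_int m * \<tau>}
        \<subseteq> translation_numbers \<kappa> b \<epsilon>"
    proof (intro subsetI)
      fix x assume "x \<in> {x \<in> translation_numbers_on {\<kappa>} f \<epsilon>. \<exists>m::int. x = of_int m * \<tau>}"
      then obtain m :: int where x: "x \<in> translation_numbers_on {\<kappa>} f \<epsilon>" "x = of_int m * \<tau>"
        by blast
      have "p (s + \<i> * complex_of_real x) = p s" for s
        unfolding x(2) by (rule periodic_int_multiple[of "Re s - 1"]) (auto simp: p half_plane_def)
      hence line: "norm (b (s + \<i> * complex_of_real x) - b s) \<le> \<epsilon>" if "Re s = \<kappa>" for s
        using x(1) that by (simp add: b_def translation_numbers_on_def)
      have "norm (b (s + \<i> * complex_of_real x) - b s) \<le> \<epsilon>" if s: "Re s \<ge> \<kappa>" for s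
      proof (rule phragmen_lindelof_half_plane
          [of "\<lambda>s. b (s + \<i> * complex_of_real x) - b s" 0 \<kappa>, OF _ \<open>\<kappa> > 0\<close> line _ s])
        have "(\<lambda>s. b (s + \<i> * complex_of_real x)) holomorphic_on half_plane 0"
          by (rule holomorphic_on_compose_gen[OF _ holb, unfolded o_def])
            (auto intro!: holomorphic_intros)
        thus "(\<lambda>s. b (s + \<i> * complex_of_real x) - b s) holomorphic_on half_plane 0"
          by (intro holomorphic_on_diff holb)
        fix \<epsilon> :: real assume "\<epsilon> > 0"
        have "norm (b (s + \<i> * complex_of_real x) - b s) \<le> (2 * \<bar>B\<bar>) * exp (\<epsilon> * Re s) * (1 + norm s)"
          if s: "Re s \<ge> \<kappa>" for s
        proof -
          have "s \<in> half_plane (\<kappa> / 2)" "s + \<i> * complex_of_real x \<in> half_plane (\<kappa> / 2)"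
            using s \<open>\<kappa> > 0\<close> by (simp_all add: half_plane_def)
          hence "norm (b (s + \<i> * complex_of_real x) - b s) \<le> 2 * \<bar>B\<bar>"
            using B[of s] B[of "s + \<i> * complex_of_real x"]
              norm_triangle_ineq4[of "b (s + \<i> * complex_of_real x)" "b s"] by linarith
          also have "\<dots> \<le> (2 * \<bar>B\<bar>) * (exp (\<epsilon> * Re s) * (1 + norm s))"
          proof -
            have "1 \<le> exp (\<epsilon> * Re s)" using \<open>\<epsilon> > 0\<close> \<open>\<kappa> > 0\<close> s by simp
            hence "1 * 1 \<le> exp (\<epsilon> * Re s) * (1 + norm s)" by (intro mult_mono) auto
            thus ?thesis using mult_left_mono[of 1 _ "2 * \<bar>B\<bar>"] by simp
          qed
          finally show ?thesis by (simp add: mult.assoc)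
        qed
        thus "\<exists>C. \<forall>s. Re s \<ge> \<kappa> \<longrightarrow>
            norm (b (s + \<i> * complex_of_real x) - b s) \<le> C * exp (\<epsilon> * Re s) * (1 + norm s)"
          by blast
      qed
      thus "x \<in> translation_numbers \<kappa> b \<epsilon>"
        by (simp add: translation_numbers_def vtranslate_def half_plane_def)
    qed
    ultimately show ?thesis by (rule relatively_dense_mono)
  qed
  moreover have "continuous_on (half_plane \<kappa>) b"
    using \<open>\<kappa> > 0\<close> by (intro holomorphic_on_imp_continuous_on holomorphic_on_subset[OF holb])
      (auto simp: half_plane_def)
  ultimately show ?thesis unfolding almost_periodic_in_def b_def by blast
qed

section \<open>The equivalence\<close>

lemma analytic_on_half_planes_iff:
  "(\<forall>\<kappa>>0. f analytic_on half_plane \<kappa>) \<longleftrightarrow> f holomorphic_on half_plane 0"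
proof
  assume "\<forall>\<kappa>>0. f analytic_on half_plane \<kappa>"
  hence "f analytic_on (\<Union>\<kappa>\<in>{0<..}. half_plane \<kappa>)"
    by (simp add: analytic_on_UN)
  also have "(\<Union>\<kappa>\<in>{0<..}. half_plane \<kappa>) = half_plane 0"
    unfolding half_plane_def by (auto simp: Bex_def intro: dense)
  finally show "f holomorphic_on half_plane 0" by (rule analytic_imp_holomorphic)
next
  assume "f holomorphic_on half_plane 0"
  hence "f analytic_on half_plane 0" by (simp add: analytic_on_open)
  thus "\<forall>\<kappa>>0. f analytic_on half_plane \<kappa>"
    by (auto elim!: analytic_on_subset simp: half_plane_def)
qed

lemma bounded_in_add:
  assumes "bounded_in \<kappa> f" "bounded_in \<kappa> g"
  shows "bounded_in \<kappa> (\<lambda>s. f s + g s)"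
  using assms unfolding bounded_in_def by (rule bounded_plus_comp)

lemma bounded_in_cong:
  assumes "\<And>s. s \<in> half_plane \<kappa> \<Longrightarrow> f s = g s"
  shows "bounded_in \<kappa> f \<longleftrightarrow> bounded_in \<kappa> g"
  using assms by (simp add: bounded_in_def cong: image_cong)

theorem theorem1:
  fixes f :: "complex \<Rightarrow> complex"
  shows "(\<forall>\<kappa>>0. \<not> bounded_in \<kappa> f \<and> f analytic_on half_plane \<kappa> \<and> almost_periodic_in \<kappa> f)
    \<longleftrightarrow>
    (\<exists>p b :: complex \<Rightarrow> complex.
        (\<forall>s\<in>half_plane 0. f s = p s + b s) \<and>
        (\<forall>\<kappa>>0. \<not> bounded_in \<kappa> p \<and> p analytic_on half_plane \<kappa> \<and> periodic_in \<kappa> p) \<and>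
        (\<forall>\<kappa>>0. bounded_in \<kappa> b \<and> b analytic_on half_plane \<kappa> \<and> almost_periodic_in \<kappa> b))"
    (is "?lhs \<longleftrightarrow> ?rhs")
proof
  assume lhs: ?lhs
  have hol: "f holomorphic_on half_plane 0"
    using lhs by (simp flip: analytic_on_half_planes_iff)
  have ap: "almost_periodic_in \<kappa> f" if "\<kappa> > 0" for \<kappa> using lhs that by blast
  obtain \<tau> where \<tau>: "\<tau> > 0" "\<tau> \<in> translation_numbers 1 f 1"
  proof -
    obtain L where "translation_numbers 1 f 1 \<inter> {0<..<0 + L} \<noteq> {}"
      using ap[of 1] unfolding almost_periodic_in_def relatively_dense_def by (meson zero_less_one)
    thus thesis using that by auto
  qed
  have incr: "norm (f (s + \<i> * complex_of_real \<tau>) - f s) \<le> 1" if "s \<in> half_plane 1" for s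
    using \<tau>(2) that by (simp add: translation_numbers_def vtranslate_def)
  obtain p where p: "p holomorphic_on half_plane 0" "\<And>s. p (s + \<i> * complex_of_real \<tau>) = p s"
      "\<And>\<kappa>. \<kappa> > 0 \<Longrightarrow> bounded_in \<kappa> (\<lambda>s. f s - p s)"
    using periodic_part_exists[OF hol \<tau>(1) almost_periodic_bounded_on_strips[OF ap] incr] by metis
  show ?rhs
  proof (intro exI conjI ballI allI impI)
    show "f s = p s + (f s - p s)" for s by simp
    fix \<kappa> :: real assume \<kappa>: "\<kappa> > 0"
    show "\<not> bounded_in \<kappa> p"
    proof
      assume "bounded_in \<kappa> p"
      from bounded_in_add[OF this p(3)[OF \<kappa>]] show False using lhs \<kappa> by simp
    qed
    show "p analytic_on half_plane \<kappa>"
      using p(1) \<kappa> by (simp flip: analytic_on_half_planes_iff)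
    show "periodic_in \<kappa> p"
      using \<tau>(1) p(2) unfolding periodic_in_def vtranslate_def by blast
    show "bounded_in \<kappa> (\<lambda>s. f s - p s)" by (rule p(3)[OF \<kappa>])
    have "(\<lambda>s. f s - p s) holomorphic_on half_plane 0"
      by (intro holomorphic_on_diff hol p)
    thus "(\<lambda>s. f s - p s) analytic_on half_plane \<kappa>"
      using \<kappa> by (simp flip: analytic_on_half_planes_iff)
    show "almost_periodic_in \<kappa> (\<lambda>s. f s - p s)"
      using \<kappa> by (intro almost_periodic_minus_periodic[OF hol ap p(1,2) \<tau>(1) p(3)]) auto
  qed
next
  assume ?rhs
  then obtain p b where f: "\<And>s. s \<in> half_plane 0 \<Longrightarrow> f s = p s + b s"
    and p: "\<forall>\<kappa>>0. \<not> bounded_in \<kappa> p \<and> p analytic_on half_plane \<kappa> \<and> periodic_in \<kappa> p"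
    and b: "\<forall>\<kappa>>0. bounded_in \<kappa> b \<and> b analytic_on half_plane \<kappa> \<and> almost_periodic_in \<kappa> b"
    by blast
  have holb: "b holomorphic_on half_plane 0" and holp: "p holomorphic_on half_plane 0"
    using p b by (simp_all flip: analytic_on_half_planes_iff)
  have "(\<lambda>s. p s + b s) holomorphic_on half_plane 0"
    by (intro holomorphic_on_add holp holb)
  hence hol: "f holomorphic_on half_plane 0"
    by (rule holomorphic_transform) (simp add: f)
  have sub: "half_plane \<kappa> \<subseteq> half_plane 0" if "\<kappa> > 0" for \<kappa>
    using that by (auto simp: half_plane_def)
  show ?lhs
  proof (intro allI impI conjI)
    fix \<kappa> :: real assume \<kappa>: "\<kappa> > 0"
    show "f analytic_on half_plane \<kappa>"
      using hol \<kappa> by (simp flip: analytic_on_half_planes_iff)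
    show "almost_periodic_in \<kappa> f"
    proof (rule almost_periodic_add_periodic[OF holb \<kappa>, of f p])
      show "continuous_on (half_plane \<kappa>) f"
        by (rule holomorphic_on_imp_continuous_on[OF holomorphic_on_subset[OF hol sub[OF \<kappa>]]])
    qed (use p b f \<kappa> sub[OF \<kappa>] in auto)
    show "\<not> bounded_in \<kappa> f"
    proof
      assume "bounded_in \<kappa> f"
      moreover have "bounded_in \<kappa> (\<lambda>s. - b s)"
        using b \<kappa> by (simp add: bounded_in_def bounded_iff)
      ultimately have "bounded_in \<kappa> (\<lambda>s. f s + - b s)" by (rule bounded_in_add)
      also have "?this \<longleftrightarrow> bounded_in \<kappa> p"
        using f sub[OF \<kappa>] by (intro bounded_in_cong) auto
      finally show False using p \<kappa> by blast
    qed
  qed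
qed

end
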